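(* Let $f:\widehat\Theta\to\mathbb{R}$ be continuous, let $(\tilde\Omega,\tilde{\mathcal F},\tilde{\mathbb P})$ be an atomless Polish probability space, let $t\in[0,T]$, and let $F(t,\cdot)$ be the lift of $f$ defined in the context. Assume that $F(t,\cdot)$ is Fréchet differentiable on $\mathbb L^2(\tilde\Omega;\widehat\Omega)$ and that $DF$ is continuous in the sense that $$\lim_{n\to\infty}\mathbb E^{\tilde{\mathbb P}}\big[|DF(t,\tilde X^n)-DF(t,\tilde X)|^2\big]=0\quad\text{whenever}\quad \lim_{n\to\infty}\mathbb E^{\tilde{\mathbb P}}\big[d_{SK}^2(\tilde X^n,\tilde X)\big]=0 .$$ Then for every $\tilde X\in\mathbb L^2(\tilde\Omega;\widehat\Omega)$ there exists an $\widehat{\mathcal F}_t$-measurable function $\psi:\widehat\Omega\to\mathbb{R}^d$ such that $DF(t,\tilde X)=\psi(\tilde X_{t\wedge\cdot})$, $\tilde{\mathbb P}$-a.s. Moreover, $\psi$ is determined by $f$ and the law $\tilde{\mathbb P}_{\tilde X}:=\tilde{\mathbb P}\circ\tilde X^{-1}$ (i.e. the same $\psi$ works for every $\tilde X'$ with $\tilde{\mathbb P}_{\tilde X'}=\tilde{\mathbb P}_{\tilde X}$), and $\psi$ is unique $\tilde{\mathbb P}_{\tilde X}$-a.s.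
   Context: Fix $T>0$, $d\ge1$. Let $\widehat\Omega=\mathbb D([0,T],\mathbb{R}^d)$ be the space of càdlàg paths, with canonical process $\widehat X$, natural filtration $\widehat{\mathbb F}=(\widehat{\mathcal F}_t)$, and Skorohod distance $d_{SK}(\widehat\omega,\widehat\omega')=\inf_\lambda\sup_{0\le t\le T}[|t-\lambda(t)|+|\widehat\omega_t-\widehat\omega'_{\lambda(t)}|]$, the infimum over continuous strictly increasing bijections $\lambda$ of $[0,T]$. Let $\widehat{\mathcal P}_2$ be the set of probability measures $\mu$ on $\widehat\Omega$ with $\mathbb E^\mu[\sup_t|\widehat X_t|^2]<\infty$, equipped with the 2-Wasserstein distance $\mathcal W_2(\mu,\nu)=\inf\big(\int d_{SK}^2(\omega_1,\omega_2)\,d\mathbb P(\omega_1,\omega_2)\big)^{1/2}$ over couplings $\mathbb P$ of $\mu,\nu$. For $\mu\in\widehat{\mathcal P}_2$, $\mu_{[0,t]}$ denotes the law of the stopped path $\widehat X_{t\wedge\cdot}$ under $\mu$. Let $\widehat\Theta=[0,T]\times\widehat{\mathcal P}_2$ with pseudometric $\mathcal W_2((t,\mu),(t',\mu'))=(|t-t'|+\mathcal W_2^2(\mu_{[0,t]},\mu'_{[0,t']}))^{1/2}$; continuity on $\widehat\Theta$ is with respect to it (so a continuous $f$ satisfies $f(t,\mu)=f(t,\mu_{[0,t]})$). $\mathbb L^2(\tilde\Omega;\widehat\Omega)$ is the set of $\tilde{\mathcal F}$-measurable $\tilde X:\tilde\Omega\to\widehat\Omega$ with $\mathbb E^{\tilde{\mathbb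 P}}[\sup_s|\tilde X_s|^2]<\infty$, and $\mathbb L^2(\tilde\Omega;\mathbb{R}^d)$ the square integrable $\mathbb{R}^d$-valued random variables. The lift is $F(t,\tilde X):=f(t,\tilde{\mathbb P}\circ\tilde X^{-1})$. $F(t,\cdot)$ is Fréchet differentiable at $\tilde X$ with derivative $DF(t,\tilde X)\in\mathbb L^2(\tilde\Omega;\mathbb{R}^d)$ if $F(t,\tilde X+\xi\mathbf 1_{[t,T]})-F(t,\tilde X)=\mathbb E^{\tilde{\mathbb P}}[DF(t,\tilde X)\cdot\xi]+o(\|\xi\|_2)$ for all $\xi\in\mathbb L^2(\tilde\Omega;\mathbb{R}^d)$, where $\|\xi\|_2^2=\mathbb E^{\tilde{\mathbb P}}[|\xi|^2]$. *)

theory Defs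
  imports "HOL-Probability.Probability"
begin

text \<open>Paths are functions real => real^'d; the space of cadlag paths on [0,T]
  (normalised to vanish outside [0,T]).\<close>

definition cadlag_paths :: "real \<Rightarrow> (real \<Rightarrow> real^'d) set" where
  "cadlag_paths T = {\<omega>. (\<forall>s. s \<notin> {0..T} \<longrightarrow> \<omega> s = 0)
     \<and> (\<forall>s\<in>{0..<T}. (\<omega> \<longlongrightarrow> \<omega> s) (at_right s))
     \<and> (\<forall>s\<in>{0<..T}. \<exists>l. (\<omega> \<longlongrightarrow> l) (at_left s))}"

definition path_filt :: "real \<Rightarrow> real \<Rightarrow> (real \<Rightarrow> real^'d) measure" where
  "path_filt T t = sigma (cadlag_paths T)
     (\<Union>s\<in>{0..t}. {(\<lambda>\<omega>. \<omega> s) -` B \<inter> cadlag_paths T | B. B \<in> sets borel})"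

definition path_space :: "real \<Rightarrow> (real \<Rightarrow> real^'d) measure" where
  "path_space T = path_filt T T"

definition stopped :: "real \<Rightarrow> real \<Rightarrow> (real \<Rightarrow> real^'d) \<Rightarrow> (real \<Rightarrow> real^'d)" where
  "stopped T t \<omega> = (\<lambda>s. if s \<in> {0..T} then \<omega> (min t s) else 0)"

definition time_changes :: "real \<Rightarrow> (real \<Rightarrow> real) set" where
  "time_changes T = {\<tau>. continuous_on {0..T} \<tau> \<and> strict_mono_on {0..T} \<tau> \<and> \<tau> ` {0..T} = {0..T}}"

definition dSK :: "real \<Rightarrow> (real \<Rightarrow> real^'d) \<Rightarrow> (real \<Rightarrow> real^'d) \<Rightarrow> real" where
  "dSK T \<omega> \<omega>' = (INF \<tau>\<in>time_changes T.
      SUP s\<in>{0..T}. \<bar>s - \<tau> s\<bar> + norm (\<omega> s - \<omega>' (\<tau> s)))"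

definition P2 :: "real \<Rightarrow> (real \<Rightarrow> real^'d) measure set" where
  "P2 T = {\<mu>. prob_space \<mu> \<and> sets \<mu> = sets (path_space T) \<and>
      (\<integral>\<^sup>+ \<omega>. (SUP s\<in>{0..T}. ennreal ((norm (\<omega> s))\<^sup>2)) \<partial>\<mu>) < \<infinity>}"

definition stopped_law :: "real \<Rightarrow> real \<Rightarrow> (real \<Rightarrow> real^'d) measure \<Rightarrow> (real \<Rightarrow> real^'d) measure" where
  "stopped_law T t \<mu> = distr \<mu> (path_space T) (stopped T t)"

definition couplings :: "real \<Rightarrow> (real \<Rightarrow> real^'d) measure \<Rightarrow> (real \<Rightarrow> real^'d) measure
     \<Rightarrow> ((real \<Rightarrow> real^'d) \<times> (real \<Rightarrow> real^'d)) measure set" where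
  "couplings T \<mu> \<nu> = {P. prob_space P \<and> sets P = sets (path_space T \<Otimes>\<^sub>M path_space T) \<and>
      distr P (path_space T) fst = \<mu> \<and> distr P (path_space T) snd = \<nu>}"

definition W2sq :: "real \<Rightarrow> (real \<Rightarrow> real^'d) measure \<Rightarrow> (real \<Rightarrow> real^'d) measure \<Rightarrow> real" where
  "W2sq T \<mu> \<nu> = enn2real (INF P\<in>couplings T \<mu> \<nu>.
      \<integral>\<^sup>+ z. ennreal ((dSK T (fst z) (snd z))\<^sup>2) \<partial>P)"

definition Theta_dist :: "real \<Rightarrow> real \<Rightarrow> (real \<Rightarrow> real^'d) measure \<Rightarrow> real
     \<Rightarrow> (real \<Rightarrow> real^'d) measure \<Rightarrow> real" where
  "Theta_dist T t \<mu> t' \<mu>' =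
     sqrt (\<bar>t - t'\<bar> + W2sq T (stopped_law T t \<mu>) (stopped_law T t' \<mu>'))"

definition Theta_continuous :: "real \<Rightarrow> (real \<Rightarrow> (real \<Rightarrow> real^'d) measure \<Rightarrow> real) \<Rightarrow> bool" where
  "Theta_continuous T f = (\<forall>t\<in>{0..T}. \<forall>\<mu>\<in>P2 T. \<forall>\<epsilon>>0. \<exists>\<delta>>0. \<forall>t'\<in>{0..T}. \<forall>\<mu>'\<in>P2 T.
      Theta_dist T t \<mu> t' \<mu>' < \<delta> \<longrightarrow> \<bar>f t \<mu> - f t' \<mu>'\<bar> < \<epsilon>)"

definition atomless :: "'a measure \<Rightarrow> bool" where
  "atomless M = (\<forall>A\<in>sets M. 0 < emeasure M A \<longrightarrow>
      (\<exists>B\<in>sets M. B \<subseteq> A \<and> 0 < emeasure M B \<and> emeasure M B < emeasure M A))"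

definition L2_paths :: "real \<Rightarrow> 'a measure \<Rightarrow> ('a \<Rightarrow> real \<Rightarrow> real^'d) set" where
  "L2_paths T P = {X. X \<in> measurable P (path_space T) \<and>
      (\<integral>\<^sup>+ \<omega>. (SUP s\<in>{0..T}. ennreal ((norm (X \<omega> s))\<^sup>2)) \<partial>P) < \<infinity>}"

definition L2_vec :: "'a measure \<Rightarrow> ('a \<Rightarrow> real^'d) set" where
  "L2_vec P = {\<xi>. \<xi> \<in> borel_measurable P \<and> integrable P (\<lambda>\<omega>. (norm (\<xi> \<omega>))\<^sup>2)}"

definition L2_norm :: "'a measure \<Rightarrow> ('a \<Rightarrow> real^'d) \<Rightarrow> real" where
  "L2_norm P \<xi> = sqrt (\<integral>\<omega>. (norm (\<xi> \<omega>))\<^sup>2 \<partial>P)"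

definition lift :: "real \<Rightarrow> 'a measure \<Rightarrow> (real \<Rightarrow> (real \<Rightarrow> real^'d) measure \<Rightarrow> real)
     \<Rightarrow> real \<Rightarrow> ('a \<Rightarrow> real \<Rightarrow> real^'d) \<Rightarrow> real" where
  "lift T P f t X = f t (distr P (path_space T) X)"

definition perturb :: "real \<Rightarrow> real \<Rightarrow> ('a \<Rightarrow> real \<Rightarrow> real^'d) \<Rightarrow> ('a \<Rightarrow> real^'d)
     \<Rightarrow> ('a \<Rightarrow> real \<Rightarrow> real^'d)" where
  "perturb T t X \<xi> = (\<lambda>\<omega> s. X \<omega> s + (if s \<in> {t..T} then \<xi> \<omega> else 0))"

definition frechet_deriv_lift :: "real \<Rightarrow> 'a measure \<Rightarrow> (real \<Rightarrow> (real \<Rightarrow> real^'d) measure \<Rightarrow> real)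
     \<Rightarrow> real \<Rightarrow> (('a \<Rightarrow> real \<Rightarrow> real^'d) \<Rightarrow> ('a \<Rightarrow> real^'d)) \<Rightarrow> bool" where
  "frechet_deriv_lift T P f t DF = (\<forall>X\<in>L2_paths T P. DF X \<in> L2_vec P \<and>
     (\<forall>\<epsilon>>0. \<exists>\<delta>>0. \<forall>\<xi>\<in>L2_vec P. L2_norm P \<xi> < \<delta> \<longrightarrow>
        \<bar>lift T P f t (perturb T t X \<xi>) - lift T P f t X - (\<integral>\<omega>. DF X \<omega> \<bullet> \<xi> \<omega> \<partial>P)\<bar>
          \<le> \<epsilon> * L2_norm P \<xi>))"

definition DF_continuous :: "real \<Rightarrow> 'a measure \<Rightarrow> (('a \<Rightarrow> real \<Rightarrow> real^'d) \<Rightarrow> ('a \<Rightarrow> real^'d)) \<Rightarrow> bool" where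
  "DF_continuous T P DF = (\<forall>Xs X. (\<forall>n. Xs n \<in> L2_paths T P) \<longrightarrow> X \<in> L2_paths T P \<longrightarrow>
      ((\<lambda>n. \<integral>\<^sup>+ \<omega>. ennreal ((dSK T (Xs n \<omega>) (X \<omega>))\<^sup>2) \<partial>P) \<longlonglongrightarrow> 0) \<longrightarrow>
      ((\<lambda>n. \<integral>\<^sup>+ \<omega>. ennreal ((norm (DF (Xs n) \<omega> - DF X \<omega>))\<^sup>2) \<partial>P) \<longlonglongrightarrow> 0))"

end

theory Submission
  imports Defs
begin

text \<open>
  Continuity of \<open>f\<close> makes the lift depend on the stopped path only, so \<open>X\<close> may be replaced by its stopped
  version. Sampling that path on a grid of mesh \<open>T/n\<close> and rounding the samples gives countably valued
  approximations that converge in the Skorohod distance and are functions of the stopped path.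

  For a countably valued \<open>Y\<close> and sets \<open>B\<close>, \<open>B'\<close> of equal probability on which \<open>Y = c\<close>, perturbing \<open>Y\<close> by
  \<open>\<epsilon> v 1\<^sub>B\<close> or by \<open>\<epsilon> v 1\<^sub>B\<^sub>'\<close> yields the same law; hence \<open>DF Y \<bullet> v\<close> has the same integral over both. As the
  space is atomless this forces \<open>DF Y\<close> to be constant on \<open>{Y = c}\<close>, and the same comparison between two
  variables with a common law shows that the constant depends on the law alone. The general case follows by
  passing to the limit in \<open>L\<^sup>2\<close>.
\<close>

text \<open>A general \<open>X\<close> need not take any single path with positive probability, so
  there may be no set on which it is constant and on which perturbations could be compared;
  countable values create such sets. The approximation has to be in \<open>dSK\<close>: a path whose
  jump misses the grid stays away from its samples in the supremum norm. Stopping before sampling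
  makes each approximation readable from \<open>path_filt T t\<close>. Constancy on a cell comes
  from comparing subsets of equal probability. Their existence is obtained on the real line: a
  measurable injection transports the measure there, and its distribution function is continuous.
  The approximate derivatives are cell averages, hence functions \<open>h n\<close> on path space,
  and \<open>\<psi>\<close> is the limit of a subsequence of them along one \<open>X\<close>. For
  \<open>X'\<close> of the same law the mean square distance between \<open>h n\<close> and
  \<open>\<psi>\<close> is the same number, so the same \<open>\<psi>\<close> serves.\<close>

section \<open>Cadlag paths and the Skorohod distance\<close>

text \<open>Real induction on [0,T]: the left limit carries \<open>Q\<close> to the supremum of the
  points reached, and right continuity carries it past that supremum. It plays the part of a finite
  partition of a cadlag path into pieces of oscillation at most \<open>e\<close>. The pieces are
  half open because the jump at a right end is arbitrary.\<close>

lemma cadlag_induct: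
  fixes x :: "real \<Rightarrow> real^'d::finite"
  assumes x: "x \<in> cadlag_paths T" and T: "0 \<le> T" and e: "0 < e"
    and Q0: "Q 0"
    and step: "\<And>a b. 0 \<le> a \<Longrightarrow> a < b \<Longrightarrow> b \<le> T \<Longrightarrow> Q a \<Longrightarrow>
      (\<And>u v. u \<in> {a..<b} \<Longrightarrow> v \<in> {a..<b} \<Longrightarrow> norm (x u - x v) \<le> e) \<Longrightarrow> Q b"
  shows "Q T"
proof -
  define S where "S = {b\<in>{0..T}. Q b}"
  define \<beta> where "\<beta> = Sup S"
  have S0: "0 \<in> S" using T Q0 by (simp add: S_def)
  have bdd: "bdd_above S" unfolding S_def by (rule bdd_aboveI[of _ T]) auto
  have \<beta>: "0 \<le> \<beta>" "\<beta> \<le> T"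
    unfolding \<beta>_def using S0 bdd by (auto intro: cSup_upper intro!: cSup_least simp: S_def)
  have "Q \<beta>"
  proof (cases "\<beta> = 0")
    case False
    then have "\<beta> \<in> {0<..T}" using \<beta> by auto
    then obtain l where l: "(x \<longlongrightarrow> l) (at_left \<beta>)" using x unfolding cadlag_paths_def by blast
    have "eventually (\<lambda>u. dist (x u) l < e/2) (at_left \<beta>)"
      using tendstoD[OF l, of "e/2"] e by simp
    then obtain c where c: "c < \<beta>" "\<And>u. c < u \<Longrightarrow> u < \<beta> \<Longrightarrow> dist (x u) l < e/2"
      by (subst (asm) eventually_at_left[of "\<beta> - 1"]) auto
    obtain a where a: "a \<in> S" "c < a"
      using c(1) S0 less_cSupD[of S c] unfolding \<beta>_def by auto
    have a\<beta>: "a \<le> \<beta>" using a bdd by (auto simp: \<beta>_def intro: cSup_upper)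
    show ?thesis
    proof (cases "a = \<beta>")
      case False
      show ?thesis
      proof (rule step)
        show "0 \<le> a" "Q a" using a by (auto simp: S_def)
        show "a < \<beta>" "\<beta> \<le> T" using a\<beta> False \<beta> by auto
        fix u v assume "u \<in> {a..<\<beta>}" "v \<in> {a..<\<beta>}"
        then have "dist (x u) l < e/2" "dist (x v) l < e/2" using a c by auto
        then have "dist (x u) (x v) < e" by (rule dist_triangle_half_l)
        then show "norm (x u - x v) \<le> e" by (simp add: dist_norm)
      qed
    qed (use a S_def in auto)
  qed (use Q0 in simp)
  have "\<beta> = T"
  proof (rule ccontr)
    assume "\<beta> \<noteq> T"
    then have \<beta>T: "\<beta> < T" using \<beta> by auto
    then have r: "(x \<longlongrightarrow> x \<beta>) (at_right \<beta>)" using x \<beta> by (auto simp: cadlag_paths_def)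
    have "eventually (\<lambda>u. dist (x u) (x \<beta>) < e/2) (at_right \<beta>)"
      using tendstoD[OF r, of "e/2"] e by simp
    then obtain c where c: "c > \<beta>" "\<And>u. \<beta> < u \<Longrightarrow> u < c \<Longrightarrow> dist (x u) (x \<beta>) < e/2"
      by (subst (asm) eventually_at_right[of _ "\<beta> + 1"]) auto
    have "Q (min c T)"
    proof (rule step[of \<beta>])
      fix u v assume "u \<in> {\<beta>..<min c T}" "v \<in> {\<beta>..<min c T}"
      then have "dist (x u) (x \<beta>) < e/2" "dist (x v) (x \<beta>) < e/2"
        using c e by (cases "u = \<beta>"; cases "v = \<beta>"; auto)+
      then have "dist (x u) (x v) < e" by (rule dist_triangle_half_l)
      then show "norm (x u - x v) \<le> e" by (simp add: dist_norm)
    qed (use \<beta> \<beta>T c \<open>Q \<beta>\<close> in auto)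
    then have "min c T \<in> S" using \<beta> \<beta>T c by (auto simp: S_def)
    then have "min c T \<le> \<beta>" using bdd by (auto simp: \<beta>_def intro: cSup_upper)
    then show False using c \<beta>T by auto
  qed
  then show ?thesis using \<open>Q \<beta>\<close> by simp
qed

lemma cadlag_bounded:
  fixes x :: "real \<Rightarrow> real^'d::finite"
  assumes x: "x \<in> cadlag_paths T" and T: "0 \<le> T"
  shows "bounded (x ` {0..T})"
proof (rule cadlag_induct[OF x T zero_less_one])
  fix a b :: real
  assume ab: "0 \<le> a" "a < b" "b \<le> T" and bd: "bounded (x ` {0..a})"
    and osc: "\<And>u v. u \<in> {a..<b} \<Longrightarrow> v \<in> {a..<b} \<Longrightarrow> norm (x u - x v) \<le> 1"
  \<comment> \<open>\<open>osc\<close> says nothing about \<open>x b\<close>, so this value enters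
    as a separate point.\<close>
  have "x ` {0..b} \<subseteq> x ` {0..a} \<union> cball (x a) 1 \<union> {x b}"
  proof
    fix y assume "y \<in> x ` {0..b}"
    then obtain s where s: "s \<in> {0..b}" "y = x s" by auto
    show "y \<in> x ` {0..a} \<union> cball (x a) 1 \<union> {x b}"
      using osc[of a s] s ab by (cases "s \<le> a"; cases "s = b"; auto simp: dist_norm)
  qed
  then show "bounded (x ` {0..b})"
    by (rule bounded_subset[rotated]) (use bd in auto)
qed simp

lemma cadlag_obtain_bound:
  fixes x :: "real \<Rightarrow> real^'d::finite"
  assumes x: "x \<in> cadlag_paths T" and T: "0 \<le> T"
  obtains M where "\<And>s. norm (x s) \<le> M" "0 \<le> M"
proof -
  obtain M where M: "\<And>s. s \<in> {0..T} \<Longrightarrow> norm (x s) \<le> M"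
    using cadlag_bounded[OF x T] unfolding bounded_iff by blast
  have "norm (x s) \<le> \<bar>M\<bar>" for s
    using M[of s] x by (cases "s \<in> {0..T}") (auto simp: cadlag_paths_def)
  then show ?thesis using that[of "\<bar>M\<bar>"] by auto
qed

text \<open>\<open>dSK\<close> takes its suprema in the reals, where the rules for them ask for
  bounded sets; boundedness of cadlag paths supplies this.\<close>

lemma time_change_bound_bdd:
  fixes x y :: "real \<Rightarrow> real^'d::finite"
  assumes "x \<in> cadlag_paths T" "y \<in> cadlag_paths T" "0 \<le> T" "\<tau> \<in> time_changes T"
  shows "bdd_above ((\<lambda>s. \<bar>s - \<tau> s\<bar> + norm (x s - y (\<tau> s))) ` {0..T})"
proof -
  obtain M where M: "\<And>s. norm (x s) \<le> M" using cadlag_obtain_bound[OF assms(1,3)] by metis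
  obtain N where N: "\<And>s. norm (y s) \<le> N" using cadlag_obtain_bound[OF assms(2,3)] by metis
  have "\<bar>s - \<tau> s\<bar> + norm (x s - y (\<tau> s)) \<le> T + (M + N)" if s: "s \<in> {0..T}" for s
  proof -
    have "\<tau> s \<in> {0..T}" using s assms(4) by (auto simp: time_changes_def)
    then have "\<bar>s - \<tau> s\<bar> \<le> T" using s by auto
    moreover have "norm (x s - y (\<tau> s)) \<le> M + N"
      using norm_triangle_ineq4[of "x s" "y (\<tau> s)"] M[of s] N[of "\<tau> s"] by linarith
    ultimately show ?thesis by linarith
  qed
  then show ?thesis by (intro bdd_aboveI[of _ "T + (M + N)"]) auto
qed

text \<open>One explicit time change bounds the infimum from above. Nonnegativity is recorded as
  well, because \<open>dSK\<close> is later squared in estimates.\<close>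

lemma dSK_upper:
  fixes x y :: "real \<Rightarrow> real^'d::finite"
  assumes xy: "x \<in> cadlag_paths T" "y \<in> cadlag_paths T" and T: "0 \<le> T" and \<tau>: "\<tau> \<in> time_changes T"
    and le: "\<And>s. s \<in> {0..T} \<Longrightarrow> \<bar>s - \<tau> s\<bar> + norm (x s - y (\<tau> s)) \<le> c"
  shows "0 \<le> dSK T x y" "dSK T x y \<le> c"
proof -
  have nn: "0 \<le> (SUP s\<in>{0..T}. \<bar>s - \<sigma> s\<bar> + norm (x s - y (\<sigma> s)))"
    if "\<sigma> \<in> time_changes T" for \<sigma>
    using T by (intro cSUP_upper2[OF time_change_bound_bdd[OF xy T that], of 0]) auto
  show "0 \<le> dSK T x y"
    unfolding dSK_def by (rule cINF_greatest) (use \<tau> nn in auto)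
  have "dSK T x y \<le> (SUP s\<in>{0..T}. \<bar>s - \<tau> s\<bar> + norm (x s - y (\<tau> s)))"
    unfolding dSK_def by (rule cINF_lower) (use \<tau> nn in \<open>auto intro!: bdd_belowI\<close>)
  also have "\<dots> \<le> c" by (rule cSUP_least) (use T le in auto)
  finally show "dSK T x y \<le> c" .
qed

lemma id_time_change: "(\<lambda>s. s) \<in> time_changes T"
  by (auto simp: time_changes_def strict_mono_on_def)

lemma dSK_le_uniform:
  fixes x y :: "real \<Rightarrow> real^'d::finite"
  assumes "x \<in> cadlag_paths T" "y \<in> cadlag_paths T" "0 \<le> T"
    and "\<And>s. s \<in> {0..T} \<Longrightarrow> norm (x s - y s) \<le> c"
  shows "0 \<le> dSK T x y" "dSK T x y \<le> c"
  using dSK_upper[OF assms(1-3) id_time_change, of c] assms(4) by auto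

lemma dSK_self:
  fixes x :: "real \<Rightarrow> real^'d::finite"
  assumes "x \<in> cadlag_paths T" "0 \<le> T"
  shows "dSK T x x = 0"
  using dSK_le_uniform[of x T x 0] assms by (intro antisym) auto

section \<open>Sampling on a grid\<close>

definition grid_index :: "real \<Rightarrow> nat \<Rightarrow> real \<Rightarrow> nat" where
  "grid_index T n s = nat \<lfloor>s * real (Suc n) / T\<rfloor>"

text \<open>The grid consists of the points \<open>i * T / Suc n\<close>; counting with
  \<open>Suc n\<close> keeps every level meaningful, and both 0 and \<open>T\<close> are grid points
  at every level.\<close>

definition grid_below :: "real \<Rightarrow> nat \<Rightarrow> real \<Rightarrow> real" where
  "grid_below T n s = T / real (Suc n) * real_of_int \<lfloor>s * real (Suc n) / T\<rfloor>"

definition grid_above :: "real \<Rightarrow> nat \<Rightarrow> real \<Rightarrow> real" where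
  "grid_above T n s = T / real (Suc n) * real_of_int \<lceil>s * real (Suc n) / T\<rceil>"

lemma grid_above_bounds:
  assumes "0 < T"
  shows "s \<le> grid_above T n s" "grid_above T n s < s + T / real (Suc n)"
proof -
  let ?v = "s * real (Suc n) / T"
  have s: "s = T / real (Suc n) * ?v" using assms by simp
  have p: "0 < T / real (Suc n)" using assms by simp
  have "T / real (Suc n) * ?v \<le> T / real (Suc n) * real_of_int \<lceil>?v\<rceil>"
    using p by (intro mult_left_mono) linarith+
  then show "s \<le> grid_above T n s" using s unfolding grid_above_def by linarith
  have "real_of_int \<lceil>?v\<rceil> < ?v + 1" by linarith
  then have "T / real (Suc n) * real_of_int \<lceil>?v\<rceil> < T / real (Suc n) * (?v + 1)"
    using p by (rule mult_strict_left_mono)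
  also have "\<dots> = s + T / real (Suc n)" using s by (simp add: distrib_left)
  finally show "grid_above T n s < s + T / real (Suc n)" unfolding grid_above_def .
qed

text \<open>This is the equivalence of floor(u) < v and u < ceiling(v), rescaled by the mesh. Hence
  the times between \<open>grid_above T n a\<close> and \<open>grid_above T n b\<close> are exactly
  those sampled in [a,b), where the path oscillates little.\<close>

lemma grid_below_less_iff:
  assumes "0 < T"
  shows "grid_below T n s < b \<longleftrightarrow> s < grid_above T n b"
proof -
  let ?u = "s * real (Suc n) / T" and ?v = "b * real (Suc n) / T"
  have "grid_below T n s < b \<longleftrightarrow> real_of_int \<lfloor>?u\<rfloor> < ?v"
    using assms unfolding grid_below_def by (simp add: field_simps)
  also have "\<dots> \<longleftrightarrow> \<lfloor>?u\<rfloor> < \<lceil>?v\<rceil>" by (simp add: less_ceiling_iff)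
  also have "\<dots> \<longleftrightarrow> ?u < real_of_int \<lceil>?v\<rceil>" by (simp add: floor_less_iff)
  also have "\<dots> \<longleftrightarrow> s < grid_above T n b"
    using assms unfolding grid_above_def by (simp add: field_simps)
  finally show ?thesis .
qed

text \<open>Matching the points \<open>grid_above T n r\<close> with \<open>r\<close> makes the sampled path follow the path itself up to
  its oscillation between consecutive matched points.\<close>

lemma sampling_time_change:
  fixes x :: "real \<Rightarrow> real^'d::finite"
  assumes x: "x \<in> cadlag_paths T" and T: "0 < T" and e: "0 < e"
  shows "\<exists>n0. \<forall>n\<ge>n0. \<exists>\<tau>\<in>time_changes T. \<forall>s\<in>{0..T}.
    \<bar>s - \<tau> s\<bar> \<le> T / real (Suc n) \<and> norm (x (grid_below T n s) - x (\<tau> s)) \<le> e"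
proof -
  let ?c = "grid_above T"
  \<comment> \<open>\<open>Q b\<close> asks for a partial time change that ends by taking
    \<open>?c n b\<close> to \<open>b\<close>. The estimate on the path omits the right end, whose
    sample belongs to the next piece.\<close>
  define Q where "Q b = (\<exists>n0. \<forall>n\<ge>n0. \<exists>\<tau>. continuous_on {0..?c n b} \<tau> \<and> strict_mono_on {0..?c n b} \<tau> \<and>
     \<tau> 0 = 0 \<and> \<tau> (?c n b) = b \<and> (\<forall>s\<in>{0..?c n b}. \<bar>s - \<tau> s\<bar> \<le> T / real (Suc n)) \<and>
     (\<forall>s\<in>{0..<?c n b}. norm (x (grid_below T n s) - x (\<tau> s)) \<le> e))" for b
  have c0: "?c n 0 = 0" for n by (simp add: grid_above_def)
  have cT: "?c n T = T" for n
  proof -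
    have "T * real (Suc n) / T = real_of_int (int (Suc n))" using T by simp
    then have "\<lceil>T * real (Suc n) / T\<rceil> = int (Suc n)" by (metis ceiling_of_int)
    then show ?thesis unfolding grid_above_def by simp
  qed
  have "Q T"
  proof (rule cadlag_induct[OF x _ e])
    show "0 \<le> T" using T by simp
    show "Q 0" unfolding Q_def using T by (auto simp: c0 strict_mono_on_def intro!: exI[of _ 0] exI[of _ "\<lambda>s. s"])
  next
    fix a b assume a: "0 \<le> a" and ab: "a < b" and "b \<le> T" and Qa: "Q a"
      and osc: "\<And>u v. u \<in> {a..<b} \<Longrightarrow> v \<in> {a..<b} \<Longrightarrow> norm (x u - x v) \<le> e"
    from Qa obtain n0 where n0: "\<And>n. n \<ge> n0 \<Longrightarrow> \<exists>\<tau>. continuous_on {0..?c n a} \<tau> \<and> strict_mono_on {0..?c n a} \<tau> \<and>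
     \<tau> 0 = 0 \<and> \<tau> (?c n a) = a \<and> (\<forall>s\<in>{0..?c n a}. \<bar>s - \<tau> s\<bar> \<le> T / real (Suc n)) \<and>
     (\<forall>s\<in>{0..<?c n a}. norm (x (grid_below T n s) - x (\<tau> s)) \<le> e)"
      unfolding Q_def by auto
    have "(\<lambda>n. T / real (Suc n)) \<longlonglongrightarrow> 0" by (rule LIMSEQ_Suc[OF lim_const_over_n])
    then have "eventually (\<lambda>n. T / real (Suc n) < b - a) sequentially"
      using ab by (intro order_tendstoD) auto
    then obtain n1 where n1: "\<And>n. n \<ge> n1 \<Longrightarrow> T / real (Suc n) < b - a"
      by (auto simp: eventually_sequentially)
    show "Q b" unfolding Q_def
    proof (intro exI[of _ "max n0 n1"] allI impI)
      fix n assume n: "max n0 n1 \<le> n"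
      define h where "h = T / real (Suc n)"
      define p where "p = ?c n a"
      define q where "q = ?c n b"
      obtain \<tau> where \<tau>: "continuous_on {0..p} \<tau>" "strict_mono_on {0..p} \<tau>" "\<tau> 0 = 0" "\<tau> p = a"
        "\<And>s. s \<in> {0..p} \<Longrightarrow> \<bar>s - \<tau> s\<bar> \<le> h" 
        "\<And>s. s \<in> {0..<p} \<Longrightarrow> norm (x (grid_below T n s) - x (\<tau> s)) \<le> e"
        using n0[of n] n unfolding h_def p_def by auto
      \<comment> \<open>A mesh shorter than the piece forces \<open>p < q\<close>, so that an affine
        map from [p,q] to [a,b] exists.\<close>
      have h: "h < b - a" using n1[of n] n unfolding h_def by simp
      have p: "a \<le> p" "p < a + h" unfolding p_def h_def using grid_above_bounds[OF T] by auto
      have q: "b \<le> q" "q < b + h" unfolding q_def h_def using grid_above_bounds[OF T] by auto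
      have pq: "p < q" using p q h by linarith
      define L where "L s = a + (s - p) * ((b - a) / (q - p))" for s
      have r: "0 < (b - a) / (q - p)" using ab pq by simp
      have Lp: "L p = a" by (simp add: L_def)
      have Lq: "L q = b" using pq by (simp add: L_def)
      have Lmono: "L s < L s'" if "s < s'" for s s'
        unfolding L_def using that r by (intro add_strict_left_mono mult_strict_right_mono) auto
      have Ldist: "\<bar>s - L s\<bar> \<le> h" if s: "p \<le> s" "s \<le> q" for s
      proof -
        define \<theta> where "\<theta> = (s - p) / (q - p)"
        have \<theta>: "0 \<le> \<theta>" "\<theta> \<le> 1" unfolding \<theta>_def using s pq by (auto simp: field_simps)
        have s\<theta>: "s = p + \<theta> * (q - p)" unfolding \<theta>_def using pq by simp
        have L\<theta>: "L s = a + \<theta> * (b - a)" unfolding L_def \<theta>_def by simp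
        \<comment> \<open>The displacement is a convex combination of the displacements
          \<open>p - a\<close> and \<open>q - b\<close> at the two ends, each of which lies between
          0 and one mesh.\<close>
        have "s - L s = (1 - \<theta>) * (p - a) + \<theta> * (q - b)"
          unfolding L\<theta> by (subst s\<theta>) (simp add: algebra_simps)
        moreover have "0 \<le> (1 - \<theta>) * (p - a) + \<theta> * (q - b)" using \<theta> p q by auto
        moreover have "(1 - \<theta>) * (p - a) + \<theta> * (q - b) \<le> (1 - \<theta>) * h + \<theta> * h"
          using \<theta> p q by (intro add_mono mult_left_mono) auto
        moreover have "(1 - \<theta>) * h + \<theta> * h = h" by (simp add: algebra_simps)
        ultimately show ?thesis by linarith
      qed
      define \<sigma> where "\<sigma> s = (if s \<le> p then \<tau> s else L s)" for s
      have "continuous_on ({0..p} \<union> {p..q}) \<sigma>"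
        unfolding \<sigma>_def
      proof (rule continuous_on_cases)
        show "continuous_on {p..q} L" unfolding L_def by (intro continuous_intros)
        show "\<forall>s. s \<in> {0..p} \<and> \<not> s \<le> p \<or> s \<in> {p..q} \<and> s \<le> p \<longrightarrow> \<tau> s = L s"
          using \<tau>(4) Lp by auto
      qed (use \<tau> in auto)
      moreover have "{0..p} \<union> {p..q} = {0..q}" using p pq a by auto
      ultimately have cont: "continuous_on {0..q} \<sigma>" by simp
      have mono: "strict_mono_on {0..q} \<sigma>"
      proof (rule strict_mono_onI)
        fix s s' assume s: "s \<in> {0..q}" "s' \<in> {0..q}" "s < s'"
        consider "s' \<le> p" | "p < s" | "s \<le> p" "p < s'" by linarith
        then show "\<sigma> s < \<sigma> s'"
        proof cases
          case 1 then show ?thesis using s strict_mono_onD[OF \<tau>(2), of s s'] by (auto simp: \<sigma>_def)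
        next
          case 2 then show ?thesis using s Lmono by (auto simp: \<sigma>_def)
        next
          case 3
          have "\<tau> s \<le> \<tau> p" using s 3 strict_mono_onD[OF \<tau>(2), of s p] by (cases "s = p") auto
          also have "\<dots> = L p" using \<tau>(4) Lp by simp
          also have "L p < L s'" using Lmono 3 by simp
          finally show ?thesis using 3 by (simp add: \<sigma>_def)
        qed
      qed
      have near: "norm (x (grid_below T n s) - x (\<sigma> s)) \<le> e" if s: "s \<in> {0..<q}" for s
      proof (cases "s < p")
        case True then show ?thesis using \<tau>(6)[of s] s by (simp add: \<sigma>_def)
      next
        case False
        have "\<sigma> s = L s" using False \<tau>(4) Lp by (cases "s = p") (auto simp: \<sigma>_def)
        moreover have "L s \<in> {a..<b}"
          using Lmono[of s q] Lmono[of p s] Lp Lq s False by (cases "s = p") auto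
        \<comment> \<open>Sample time and matched time both lie in [a,b), so \<open>osc\<close>
          compares them.\<close>
        moreover have "grid_below T n s \<in> {a..<b}"
          using grid_below_less_iff[OF T, of n s a] grid_below_less_iff[OF T, of n s b] False s
          unfolding p_def q_def by auto
        ultimately show ?thesis using osc by simp
      qed
      have "\<sigma> 0 = 0" "\<sigma> q = b" using p pq a \<tau>(3) Lq by (auto simp: \<sigma>_def)
      moreover have "\<bar>s - \<sigma> s\<bar> \<le> h" if "s \<in> {0..q}" for s
        using \<tau>(5)[of s] Ldist[of s] that by (auto simp: \<sigma>_def)
      ultimately show "\<exists>\<tau>. continuous_on {0..?c n b} \<tau> \<and> strict_mono_on {0..?c n b} \<tau> \<and>
     \<tau> 0 = 0 \<and> \<tau> (?c n b) = b \<and> (\<forall>s\<in>{0..?c n b}. \<bar>s - \<tau> s\<bar> \<le> T / real (Suc n)) \<and>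
     (\<forall>s\<in>{0..<?c n b}. norm (x (grid_below T n s) - x (\<tau> s)) \<le> e)"
        using cont mono near unfolding h_def q_def by (intro exI[of _ \<sigma>]) auto
    qed
  qed
  then obtain n0 where n0: "\<And>n. n \<ge> n0 \<Longrightarrow> \<exists>\<tau>. continuous_on {0..T} \<tau> \<and> strict_mono_on {0..T} \<tau> \<and>
     \<tau> 0 = 0 \<and> \<tau> T = T \<and> (\<forall>s\<in>{0..T}. \<bar>s - \<tau> s\<bar> \<le> T / real (Suc n)) \<and>
     (\<forall>s\<in>{0..<T}. norm (x (grid_below T n s) - x (\<tau> s)) \<le> e)"
    unfolding Q_def cT by auto
  show ?thesis
  proof (intro exI[of _ n0] allI impI)
    fix n assume "n0 \<le> n"
    then obtain \<tau> where \<tau>: "continuous_on {0..T} \<tau>" "strict_mono_on {0..T} \<tau>"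
     "\<tau> 0 = 0" "\<tau> T = T" "\<And>s. s \<in> {0..T} \<Longrightarrow> \<bar>s - \<tau> s\<bar> \<le> T / real (Suc n)"
     "\<And>s. s \<in> {0..<T} \<Longrightarrow> norm (x (grid_below T n s) - x (\<tau> s)) \<le> e"
      using n0 by metis
    have mono: "\<tau> s \<le> \<tau> s'" if "s \<in> {0..T}" "s' \<in> {0..T}" "s \<le> s'" for s s'
      using strict_mono_onD[OF \<tau>(2), of s s'] that by (cases "s = s'") auto
    have "\<tau> ` {0..T} = {0..T}"
    proof (intro antisym subsetI)
      fix y assume "y \<in> \<tau> ` {0..T}"
      then obtain s where s: "s \<in> {0..T}" "y = \<tau> s" by auto
      then show "y \<in> {0..T}" using mono[of 0 s] mono[of s T] \<tau>(3,4) by auto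
    next
      fix y assume "y \<in> {0..T}"
      then have "\<exists>s\<ge>0. s \<le> T \<and> \<tau> s = y"
        using \<tau> T by (intro IVT') auto
      then show "y \<in> \<tau> ` {0..T}" by auto
    qed
    then have tc: "\<tau> \<in> time_changes T" using \<tau> by (simp add: time_changes_def)
    \<comment> \<open>The induction leaves \<open>s = T\<close> open; there the sample time and the
      matched time are both \<open>T\<close>.\<close>
    have "grid_below T n T = T"
    proof -
      have "T * real (Suc n) / T = real_of_int (int (Suc n))" using T by simp
      then have "\<lfloor>T * real (Suc n) / T\<rfloor> = int (Suc n)" by (metis floor_of_int)
      then show ?thesis unfolding grid_below_def by simp
    qed
    then have "norm (x (grid_below T n s) - x (\<tau> s)) \<le> e" if "s \<in> {0..T}" for s
      using \<tau>(4) \<tau>(6)[of s] that e by (cases "s = T") auto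
    then show "\<exists>\<tau>\<in>time_changes T. \<forall>s\<in>{0..T}.
      \<bar>s - \<tau> s\<bar> \<le> T / real (Suc n) \<and> norm (x (grid_below T n s) - x (\<tau> s)) \<le> e"
      using tc \<tau>(5) by blast
  qed
qed

section \<open>Discretising a path\<close>

text \<open>The codes live in a countable type, so almost sure statements can be collected over all
  codes and measurability reduces to single codes. There are n + 2 entries because the sample at
  \<open>T\<close> is included.\<close>

definition path_code :: "real \<Rightarrow> nat \<Rightarrow> (real \<Rightarrow> real^'d) \<Rightarrow> (int^'d) list" where
  "path_code T n x = map (\<lambda>i. \<chi> j. \<lfloor>real (Suc n) * x (real i * T / real (Suc n)) $ j\<rfloor>) [0..<Suc (Suc n)]"

definition path_decode :: "real \<Rightarrow> nat \<Rightarrow> (int^'d) list \<Rightarrow> real \<Rightarrow> real^'d" where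
  "path_decode T n l = (\<lambda>s. if s \<in> {0..T} then \<chi> j. real_of_int (l ! grid_index T n s $ j) / real (Suc n) else 0)"

text \<open>Rounding down costs at most \<open>1 / Suc n\<close> in each coordinate, and the norm is
  at most the sum of the absolute coordinates; hence the factor \<open>CARD('d)\<close>.\<close>

lemma norm_path_decode_diff:
  fixes x :: "real \<Rightarrow> real^'d::finite"
  assumes T: "0 < T" and s: "s \<in> {0..T}"
  shows "norm (path_decode T n (path_code T n x) s - x (grid_below T n s)) \<le> real CARD('d) / real (Suc n)"
proof -
  let ?k = "\<lfloor>s * real (Suc n) / T\<rfloor>" and ?N = "real (Suc n)"
  let ?v = "x (grid_below T n s)"
  have k0: "0 \<le> ?k" using s T by simp
  have "s * ?N \<le> T * ?N" using s by (intro mult_right_mono) auto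
  then have "s * ?N / T \<le> ?N" using T by (simp add: pos_divide_le_eq mult.commute del: of_nat_Suc)
  then have kN: "?k \<le> int (Suc n)" by linarith
  have i: "grid_index T n s < Suc (Suc n)" unfolding grid_index_def using k0 kN by linarith
  have g: "real (grid_index T n s) * T / ?N = grid_below T n s"
    unfolding grid_index_def grid_below_def using k0 by simp
  have d: "path_decode T n (path_code T n x) s = (\<chi> j. real_of_int \<lfloor>?N * ?v $ j\<rfloor> / ?N)"
    using i s g unfolding path_decode_def path_code_def by (simp del: upt_Suc of_nat_Suc)
  have comp: "\<bar>real_of_int \<lfloor>?N * a\<rfloor> / ?N - a\<bar> \<le> 1 / ?N" for a
  proof -
    have "\<bar>real_of_int \<lfloor>?N * a\<rfloor> - ?N * a\<bar> \<le> 1" by linarith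
    then have "\<bar>real_of_int \<lfloor>?N * a\<rfloor> - ?N * a\<bar> / ?N \<le> 1 / ?N" by (intro divide_right_mono) auto
    moreover have "real_of_int \<lfloor>?N * a\<rfloor> / ?N - a = (real_of_int \<lfloor>?N * a\<rfloor> - ?N * a) / ?N"
      by (simp add: diff_divide_distrib)
    then have "\<bar>real_of_int \<lfloor>?N * a\<rfloor> / ?N - a\<bar> = \<bar>real_of_int \<lfloor>?N * a\<rfloor> - ?N * a\<bar> / ?N"
      by (simp only: abs_divide abs_of_nat)
    ultimately show ?thesis by simp
  qed
  have "norm (path_decode T n (path_code T n x) s - ?v)
      \<le> (\<Sum>j\<in>UNIV. \<bar>(path_decode T n (path_code T n x) s - ?v) $ j\<bar>)"
    by (rule norm_le_l1_cart)
  also have "\<dots> \<le> (\<Sum>j\<in>(UNIV::'d set). 1 / ?N)"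
    unfolding d using comp by (intro sum_mono) (simp del: of_nat_Suc)
  also have "\<dots> = real CARD('d) / ?N" by simp
  finally show ?thesis .
qed

lemma eventually_floor_at_right:
  fixes c s :: real
  assumes "0 < c"
  shows "eventually (\<lambda>u. \<lfloor>u * c\<rfloor> = \<lfloor>s * c\<rfloor>) (at_right s)"
proof -
  let ?b = "(real_of_int \<lfloor>s * c\<rfloor> + 1) / c"
  have "s * c < real_of_int \<lfloor>s * c\<rfloor> + 1" by linarith
  then have b: "s < ?b" using assms by (simp add: field_simps)
  show ?thesis
    unfolding eventually_at_right[OF b]
  proof (intro exI[of _ ?b] conjI allI impI b)
    fix u assume u: "s < u" "u < ?b"
    have "s * c < u * c" "u * c < real_of_int \<lfloor>s * c\<rfloor> + 1"
      using u assms by (auto simp: field_simps)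
    then show "\<lfloor>u * c\<rfloor> = \<lfloor>s * c\<rfloor>" by linarith
  qed
qed

text \<open>Ceiling minus one covers both cases: it is the floor when \<open>s * c\<close> is not an
  integer, and the value before the jump when it is.\<close>

lemma eventually_floor_at_left:
  fixes c s :: real
  assumes "0 < c"
  shows "eventually (\<lambda>u. \<lfloor>u * c\<rfloor> = \<lceil>s * c\<rceil> - 1) (at_left s)"
proof -
  let ?b = "(real_of_int \<lceil>s * c\<rceil> - 1) / c"
  have "s * c > real_of_int \<lceil>s * c\<rceil> - 1" by linarith
  then have b: "?b < s" using assms by (simp add: field_simps)
  show ?thesis
    unfolding eventually_at_left[OF b]
  proof (intro exI[of _ ?b] conjI allI impI b)
    fix u assume u: "?b < u" "u < s"
    have "u * c < s * c" "u * c > real_of_int \<lceil>s * c\<rceil> - 1"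
      using u assms by (auto simp: field_simps)
    then show "\<lfloor>u * c\<rfloor> = \<lceil>s * c\<rceil> - 1" by linarith
  qed
qed

lemma path_decode_cadlag:
  assumes T: "0 < T"
  shows "(path_decode T n l :: real \<Rightarrow> real^'d::finite) \<in> cadlag_paths T"
  unfolding cadlag_paths_def
proof (intro CollectI conjI ballI allI impI)
  define H :: "int \<Rightarrow> real^'d" where "H k = (\<chi> j. real_of_int (l ! nat k $ j) / real (Suc n))" for k
  define c where "c = real (Suc n) / T"
  have c: "0 < c" using T by (simp add: c_def)
  have eq: "path_decode T n l u = H \<lfloor>u * c\<rfloor>" if "u \<in> {0..T}" for u
    using that by (simp add: path_decode_def H_def c_def grid_index_def)
  {
    fix s assume s: "s \<in> {0..<T}"
    have "eventually (\<lambda>u. u < T \<and> u > s) (at_right s)"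
      using s by (auto simp: eventually_at_right[of s T])
    then have "eventually (\<lambda>u. path_decode T n l u = path_decode T n l s) (at_right s)"
      using eventually_floor_at_right[OF c]
    proof eventually_elim
      case (elim u)
      then show ?case using eq[of u] eq[of s] s by auto
    qed
    then show "(path_decode T n l \<longlongrightarrow> path_decode T n l s) (at_right s)"
      by (rule tendsto_eventually)
  next
    fix s assume s: "s \<in> {0<..T}"
    have "eventually (\<lambda>u. u > 0 \<and> u < s) (at_left s)"
      using s by (auto simp: eventually_at_left[of 0 s])
    then have "eventually (\<lambda>u. path_decode T n l u = H (\<lceil>s * c\<rceil> - 1)) (at_left s)"
      using eventually_floor_at_left[OF c]
    proof eventually_elim
      case (elim u)
      then show ?case using eq[of u] s by auto
    qed
    then show "\<exists>v. (path_decode T n l \<longlongrightarrow> v) (at_left s)"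
      by (intro exI) (rule tendsto_eventually)
  next
    fix s assume "s \<notin> {0..T}"
    then show "path_decode T n l s = 0" by (auto simp: path_decode_def)
  }
qed

text \<open>The decoded path jumps at grid points only, so it follows \<open>x\<close> only after a
  change of time. Three errors add up: the time shift \<open>T / Suc n\<close>, the rounding
  \<open>CARD('d) / Suc n\<close> and the oscillation \<open>e/2\<close>.\<close>

lemma dSK_path_code_tendsto:
  fixes x :: "real \<Rightarrow> real^'d::finite"
  assumes x: "x \<in> cadlag_paths T" and T: "0 < T"
  shows "(\<lambda>n. dSK T (path_decode T n (path_code T n x)) x) \<longlonglongrightarrow> 0"
proof (rule tendstoI)
  fix e :: real assume e: "0 < e"
  let ?y = "\<lambda>n. path_decode T n (path_code T n x)"
  obtain n0 where n0: "\<And>n. n \<ge> n0 \<Longrightarrow> \<exists>\<tau>\<in>time_changes T. \<forall>s\<in>{0..T}.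
    \<bar>s - \<tau> s\<bar> \<le> T / real (Suc n) \<and> norm (x (grid_below T n s) - x (\<tau> s)) \<le> e/2"
    using sampling_time_change[OF x T, of "e/2"] e by auto
  have "(\<lambda>n. (T + real CARD('d)) / real (Suc n)) \<longlonglongrightarrow> 0"
    by (rule LIMSEQ_Suc[OF lim_const_over_n])
  then have "eventually (\<lambda>n. (T + real CARD('d)) / real (Suc n) < e/2) sequentially"
    using e by (intro order_tendstoD) auto
  moreover have "eventually (\<lambda>n. n \<ge> n0) sequentially" by (rule eventually_ge_at_top)
  ultimately show "eventually (\<lambda>n. dist (dSK T (?y n) x) 0 < e) sequentially"
  proof eventually_elim
    case (elim n)
    obtain \<tau> where \<tau>: "\<tau> \<in> time_changes T" "\<And>s. s \<in> {0..T} \<Longrightarrow> \<bar>s - \<tau> s\<bar> \<le> T / real (Suc n)"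
      "\<And>s. s \<in> {0..T} \<Longrightarrow> norm (x (grid_below T n s) - x (\<tau> s)) \<le> e/2"
      using n0[OF elim(2)] by blast
    have *: "\<bar>s - \<tau> s\<bar> + norm (?y n s - x (\<tau> s)) \<le> (T + real CARD('d)) / real (Suc n) + e/2"
      if s: "s \<in> {0..T}" for s
    proof -
      have "norm (?y n s - x (\<tau> s)) \<le> norm (?y n s - x (grid_below T n s)) + norm (x (grid_below T n s) - x (\<tau> s))"
        using norm_triangle_ineq[of "?y n s - x (grid_below T n s)" "x (grid_below T n s) - x (\<tau> s)"] by simp
      also have "\<dots> \<le> real CARD('d) / real (Suc n) + e/2"
        using norm_path_decode_diff[OF T s, of n x] \<tau>(3)[OF s] by linarith
      finally show ?thesis using \<tau>(2)[OF s] by (simp add: add_divide_distrib)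
    qed
    have "0 \<le> dSK T (?y n) x" "dSK T (?y n) x \<le> (T + real CARD('d)) / real (Suc n) + e/2"
      using dSK_upper[OF path_decode_cadlag[OF T] x _ \<tau>(1) *] T by auto
    then show ?case using elim(1) unfolding dist_real_def by linarith
  qed
qed

text \<open>Crude bounds from the identity time change. They are linear in \<open>M\<close> and
  uniform in \<open>n\<close>, which yields a square integrable majorant.\<close>

lemma dSK_path_code_le:
  fixes x :: "real \<Rightarrow> real^'d::finite"
  assumes x: "x \<in> cadlag_paths T" and T: "0 < T" and M: "\<And>s. s \<in> {0..T} \<Longrightarrow> norm (x s) \<le> M"
  shows "0 \<le> dSK T (path_decode T n (path_code T n x)) x"
    "dSK T (path_decode T n (path_code T n x)) x \<le> 2 * M + real CARD('d)"
    "\<And>s. s \<in> {0..T} \<Longrightarrow> norm (path_decode T n (path_code T n x) s) \<le> M + real CARD('d)"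
proof -
  let ?y = "path_decode T n (path_code T n x)"
  have *: "norm (?y s) \<le> M + real CARD('d)" if s: "s \<in> {0..T}" for s
  proof -
    have g: "grid_below T n s \<in> {0..T}"
    proof -
      have k: "0 \<le> \<lfloor>s * real (Suc n) / T\<rfloor>" using s T by simp
      have "T / real (Suc n) * real_of_int \<lfloor>s * real (Suc n) / T\<rfloor> \<le> T / real (Suc n) * (s * real (Suc n) / T)"
        using T by (intro mult_left_mono) auto
      also have "\<dots> = s" using T by simp
      finally show ?thesis using s T k unfolding grid_below_def by simp
    qed
    have "norm (?y s) \<le> norm (?y s - x (grid_below T n s)) + norm (x (grid_below T n s))"
      using norm_triangle_ineq[of "?y s - x (grid_below T n s)" "x (grid_below T n s)"] by simp
    also have "\<dots> \<le> real CARD('d) / real (Suc n) + M"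
      using norm_path_decode_diff[OF T s, of n x] M[OF g] by linarith
    also have "real CARD('d) / real (Suc n) \<le> real CARD('d)"
      by (simp add: field_simps)
    finally show ?thesis by simp
  qed
  then show "\<And>s. s \<in> {0..T} \<Longrightarrow> norm (?y s) \<le> M + real CARD('d)" .
  have "norm (?y s - x s) \<le> 2 * M + real CARD('d)" if s: "s \<in> {0..T}" for s
    using norm_triangle_ineq4[of "?y s" "x s"] *[OF s] M[OF s] by linarith
  then show "0 \<le> dSK T ?y x" "dSK T ?y x \<le> 2 * M + real CARD('d)"
    using dSK_le_uniform[OF path_decode_cadlag[OF T] x] T by auto
qed

section \<open>Measurability on path space\<close>

lemma path_filt_generators:
  "(\<Union>s\<in>{0..t}. {(\<lambda>\<omega>. \<omega> s) -` B \<inter> cadlag_paths T | B. B \<in> sets borel}) \<subseteq> Pow (cadlag_paths T)"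
  by auto

lemma space_path_filt [simp]: "space (path_filt T t) = cadlag_paths T"
  unfolding path_filt_def by (rule space_measure_of[OF path_filt_generators])

lemma space_path_space [simp]: "space (path_space T) = cadlag_paths T"
  unfolding path_space_def by simp

lemma measurable_path_filtI:
  fixes X :: "'a \<Rightarrow> real \<Rightarrow> real^'d::finite"
  assumes "\<And>w. w \<in> space M \<Longrightarrow> X w \<in> cadlag_paths T"
    and "\<And>s. s \<in> {0..t} \<Longrightarrow> (\<lambda>w. X w s) \<in> borel_measurable M"
  shows "X \<in> measurable M (path_filt T t)"
  unfolding path_filt_def
proof (rule measurable_measure_of[OF path_filt_generators])
  show "X \<in> space M \<rightarrow> cadlag_paths T" using assms(1) by auto
  fix y assume "y \<in> (\<Union>s\<in>{0..t}. {(\<lambda>\<omega>::real \<Rightarrow> real^'d. \<omega> s) -` B \<inter> cadlag_paths T | B. B \<in> sets borel})"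
  then obtain s B where s: "s \<in> {0..t}" and B: "B \<in> sets borel" "y = (\<lambda>\<omega>. \<omega> s) -` B \<inter> cadlag_paths T"
    by auto
  have "X -` y \<inter> space M = (\<lambda>w. X w s) -` B \<inter> space M"
    using assms(1) by (auto simp: B)
  then show "X -` y \<inter> space M \<in> sets M"
    using measurable_sets[OF assms(2)[OF s] B(1)] by simp
qed

lemma measurable_path_eval:
  assumes "s \<in> {0..t}"
  shows "(\<lambda>x::real \<Rightarrow> real^'d::finite. x s) \<in> borel_measurable (path_filt T t)"
proof (rule measurableI)
  fix B :: "(real^'d) set" assume B: "B \<in> sets borel"
  show "(\<lambda>x. x s) -` B \<inter> space (path_filt T t) \<in> sets (path_filt T t)"
    unfolding space_path_filt unfolding path_filt_def sets_measure_of[OF path_filt_generators]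
    using assms B by (intro sigma_sets.Basic) blast
qed simp

lemma measurable_path_space_eval:
  assumes "0 \<le> T" "X \<in> measurable M (path_space T)"
  shows "(\<lambda>w. X w s) \<in> borel_measurable M"
proof (cases "s \<in> {0..T}")
  case True
  show ?thesis
    using measurable_compose[OF assms(2)[unfolded path_space_def] measurable_path_eval[OF True]] .
next
  case False
  have "X w s = 0" if "w \<in> space M" for w
    using measurable_space[OF assms(2) that] False by (auto simp: cadlag_paths_def)
  then show ?thesis by (subst measurable_cong[where g="\<lambda>_. 0"]) auto
qed

text \<open>The inclusion of the two sigma-algebras, phrased through the identity map so that it can
  be composed.\<close>

lemma path_filt_mono:
  assumes "t \<le> T"
  shows "(\<lambda>x. x) \<in> measurable (path_space T) (path_filt T t)"
  using assms by (intro measurable_path_filtI) (auto simp: path_space_def intro!: measurable_path_eval)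

lemma stopped_cadlag:
  fixes x :: "real \<Rightarrow> real^'d::finite"
  assumes x: "x \<in> cadlag_paths T" and t: "t \<in> {0..T}"
  shows "stopped T t x \<in> cadlag_paths T"
  unfolding cadlag_paths_def
proof (intro CollectI conjI ballI allI impI)
  fix s assume s: "s \<in> {0..<T}"
  show "(stopped T t x \<longlongrightarrow> stopped T t x s) (at_right s)"
  proof (cases "s < t")
    case True
    have "eventually (\<lambda>u. u < t \<and> u > s) (at_right s)"
      using True by (auto simp: eventually_at_right[of s t])
    then have "eventually (\<lambda>u. x u = stopped T t x u) (at_right s)"
      by eventually_elim (use s t in \<open>auto simp: stopped_def\<close>)
    moreover have "(x \<longlongrightarrow> x s) (at_right s)" using x s by (simp add: cadlag_paths_def)
    ultimately show ?thesis
      using True s by (subst tendsto_cong[symmetric]) (auto simp: stopped_def)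
  next
    case False
    have "eventually (\<lambda>u. u < T \<and> u > s) (at_right s)"
      using s by (auto simp: eventually_at_right[of s T])
    then have "eventually (\<lambda>u. stopped T t x u = stopped T t x s) (at_right s)"
      by eventually_elim (use False s t in \<open>auto simp: stopped_def min_def\<close>)
    then show ?thesis by (rule tendsto_eventually)
  qed
next
  fix s assume s: "s \<in> {0<..T}"
  show "\<exists>l. (stopped T t x \<longlongrightarrow> l) (at_left s)"
  proof (cases "s \<le> t")
    case True
    have "eventually (\<lambda>u. u > 0 \<and> u < s) (at_left s)"
      using s by (auto simp: eventually_at_left[of 0 s])
    then have "eventually (\<lambda>u. x u = stopped T t x u) (at_left s)"
      by eventually_elim (use True s t in \<open>auto simp: stopped_def\<close>)
    moreover obtain l where "(x \<longlongrightarrow> l) (at_left s)" using x s unfolding cadlag_paths_def by blast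
    ultimately show ?thesis
      by (intro exI[of _ l]) (subst tendsto_cong[symmetric], auto)
  next
    case False
    then have "eventually (\<lambda>u. u > t \<and> u < s) (at_left s)"
      by (intro eventually_at_leftI[of t s]) auto
    then have "eventually (\<lambda>u. stopped T t x u = x t) (at_left s)"
      by eventually_elim (use False s t in \<open>auto simp: stopped_def min_def\<close>)
    then show ?thesis by (intro exI) (rule tendsto_eventually)
  qed
qed (auto simp: stopped_def)

lemma jump_cadlag:
  fixes x :: "real \<Rightarrow> real^'d::finite"
  assumes x: "x \<in> cadlag_paths T" and t: "t \<in> {0..T}"
  shows "(\<lambda>s. x s + (if s \<in> {t..T} then v else 0)) \<in> cadlag_paths T"
  unfolding cadlag_paths_def
proof (intro CollectI conjI ballI allI impI)
  let ?j = "\<lambda>s. if s \<in> {t..T} then v else 0"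
  fix s assume s: "s \<in> {0..<T}"
  have "eventually (\<lambda>u. u < (if s < t then t else T) \<and> u > s) (at_right s)"
    using s by (auto simp: eventually_at_right[of s T] eventually_at_right[of s t])
  then have "eventually (\<lambda>u. ?j u = ?j s) (at_right s)"
    by eventually_elim (use s t in \<open>auto split: if_splits\<close>)
  then have "(?j \<longlongrightarrow> ?j s) (at_right s)" by (rule tendsto_eventually)
  moreover have "(x \<longlongrightarrow> x s) (at_right s)" using x s by (simp add: cadlag_paths_def)
  ultimately show "((\<lambda>s. x s + ?j s) \<longlongrightarrow> x s + ?j s) (at_right s)" by (intro tendsto_add)
next
  let ?j = "\<lambda>s. if s \<in> {t..T} then v else 0"
  fix s assume s: "s \<in> {0<..T}"
  have "eventually (\<lambda>u. u > (if s \<le> t then 0 else t) \<and> u < s) (at_left s)"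
    using s by (intro eventually_at_leftI[of "if s \<le> t then 0 else t"]) auto
  then have "eventually (\<lambda>u. ?j u = (if s \<le> t then 0 else v)) (at_left s)"
    by eventually_elim (use s t in \<open>auto split: if_splits\<close>)
  then have "(?j \<longlongrightarrow> (if s \<le> t then 0 else v)) (at_left s)" by (rule tendsto_eventually)
  moreover obtain l where "(x \<longlongrightarrow> l) (at_left s)" using x s unfolding cadlag_paths_def by blast
  ultimately show "\<exists>l. ((\<lambda>s. x s + ?j s) \<longlongrightarrow> l) (at_left s)" by (intro exI) (rule tendsto_add)
next
  fix s assume "s \<notin> {0..T}"
  then show "x s + (if s \<in> {t..T} then v else 0) = 0" using x t by (auto simp: cadlag_paths_def)
qed

text \<open>The source is \<open>path_filt T t\<close>, because the stopped path reads its argument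
  only at the times \<open>min t s\<close>. This is where the measurability of \<open>\<psi>\<close>
  with respect to time \<open>t\<close> originates.\<close>

lemma measurable_stopped:
  assumes "t \<in> {0..T}"
  shows "stopped T t \<in> measurable (path_filt T t) (path_space T :: (real \<Rightarrow> real^'d::finite) measure)"
  unfolding path_space_def
proof (rule measurable_path_filtI)
  fix s assume s: "s \<in> {0..T}"
  have "(\<lambda>x. x (min t s)) \<in> borel_measurable (path_filt T t)"
    using assms s by (intro measurable_path_eval) auto
  then show "(\<lambda>x::real \<Rightarrow> real^'d. stopped T t x s) \<in> borel_measurable (path_filt T t)"
    using s by (simp add: stopped_def)
qed (use assms in \<open>auto intro: stopped_cadlag\<close>)

lemma measurable_path_code:
  assumes "0 < T"
  shows "path_code T n \<in> measurable (path_space T :: (real \<Rightarrow> real^'d::finite) measure) (count_space UNIV)"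
proof -
  have "{x \<in> cadlag_paths T. path_code T n x = l} \<in> sets (path_space T)" for l :: "(int^'d) list"
  proof (cases "length l = Suc (Suc n)")
    case True
    have grid: "real i * T / real (Suc n) \<in> {0..T}" if "i \<in> {..<Suc (Suc n)}" for i
      using that assms by (auto simp: field_simps simp flip: of_nat_Suc)
    have [measurable]: "(\<lambda>x::real \<Rightarrow> real^'d. x (real i * T / real (Suc n))) \<in> borel_measurable (path_space T)"
      if "i \<in> {..<Suc (Suc n)}" for i
      unfolding path_space_def by (rule measurable_path_eval[OF grid[OF that]])
    have "(path_code T n x = l) \<longleftrightarrow>
        (\<forall>i\<in>{..<Suc (Suc n)}. \<forall>j. \<lfloor>real (Suc n) * x (real i * T / real (Suc n)) $ j\<rfloor> = l ! i $ j)" for x :: "real \<Rightarrow> real^'d"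
      unfolding path_code_def list_eq_iff_nth_eq using True by (auto simp: vec_eq_iff simp del: upt_Suc of_nat_Suc)
    then have "{x \<in> cadlag_paths T. path_code T n x = l} = {x \<in> space (path_space T).
        \<forall>i\<in>{..<Suc (Suc n)}. \<forall>j\<in>UNIV. \<lfloor>real (Suc n) * (x (real i * T / real (Suc n)) \<bullet> axis j 1)\<rfloor> = l ! i $ j}"
      by (simp add: cart_eq_inner_axis)
    also have "\<dots> \<in> sets (path_space T)" by measurable
    finally show ?thesis .
  next
    case False
    then have "{x \<in> cadlag_paths T. path_code T n x = l} = {}" by (auto simp: path_code_def)
    then show ?thesis by (simp only: sets.empty_sets)
  qed
  then show ?thesis
    by (subst measurable_count_space_eq_countable) (auto simp: vimage_def Int_def conj_commute)
qed

text \<open>By right continuity the value at \<open>s\<close> is approached by values at rationals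
  after \<open>s\<close>. The end \<open>T\<close> has no such neighbours inside the interval and is
  added by hand. A countable supremum is measurable.\<close>

lemma sup_norm_sq_countable:
  fixes x :: "real \<Rightarrow> real^'d::finite"
  assumes x: "x \<in> cadlag_paths T" and T: "0 \<le> T"
  shows "(SUP s\<in>{0..T}. ennreal ((norm (x s))\<^sup>2)) = (SUP s\<in>insert T ({0..T} \<inter> \<rat>). ennreal ((norm (x s))\<^sup>2))"
proof (rule antisym)
  show "(SUP s\<in>insert T ({0..T} \<inter> \<rat>). ennreal ((norm (x s))\<^sup>2)) \<le> (SUP s\<in>{0..T}. ennreal ((norm (x s))\<^sup>2))"
    using T by (intro SUP_subset_mono) auto
  let ?R = "SUP s\<in>insert T ({0..T} \<inter> \<rat>). ennreal ((norm (x s))\<^sup>2)"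
  show "(SUP s\<in>{0..T}. ennreal ((norm (x s))\<^sup>2)) \<le> ?R"
  proof (rule SUP_least)
    fix s assume s: "s \<in> {0..T}"
    show "ennreal ((norm (x s))\<^sup>2) \<le> ?R"
    proof (cases "s = T")
      case True then show ?thesis by (intro SUP_upper) auto
    next
      case False
      then have sT: "s < T" using s by auto
      have "(x \<longlongrightarrow> x s) (at_right s)" using x s sT by (auto simp: cadlag_paths_def)
      then have lim: "((\<lambda>u. ennreal ((norm (x u))\<^sup>2)) \<longlongrightarrow> ennreal ((norm (x s))\<^sup>2)) (at_right s)"
        by (intro tendsto_ennrealI tendsto_intros)
      show ?thesis
      proof (rule ccontr)
        assume "\<not> ?thesis"
        then have "eventually (\<lambda>u. ?R < ennreal ((norm (x u))\<^sup>2)) (at_right s)"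
          using lim by (intro order_tendstoD(1)[OF lim]) simp
        then obtain b where b: "b > s" "\<And>u. s < u \<Longrightarrow> u < b \<Longrightarrow> ?R < ennreal ((norm (x u))\<^sup>2)"
          unfolding eventually_at_right[OF sT] by blast
        obtain q where q: "q \<in> \<rat>" "s < q" "q < min b T"
          using Rats_dense_in_real[of s "min b T"] b sT by auto
        have "ennreal ((norm (x q))\<^sup>2) \<le> ?R" using q s by (intro SUP_upper) auto
        then show False using b(2)[of q] q by auto
      qed
    qed
  qed
qed

lemma measurable_sup_norm_sq:
  assumes T: "0 \<le> T" and X: "X \<in> measurable M (path_space T)"
  shows "(\<lambda>w. SUP s\<in>{0..T}. ennreal ((norm (X w s :: real^'d::finite))\<^sup>2)) \<in> borel_measurable M"
proof -
  have "(\<lambda>w. SUP s\<in>insert T ({0..T} \<inter> \<rat>). ennreal ((norm (X w s))\<^sup>2)) \<in> borel_measurable M"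
    using measurable_path_space_eval[OF T X]
    by (intro borel_measurable_SUP) (auto intro!: countable_Int2 countable_rat)
  moreover have "X w \<in> cadlag_paths T" if "w \<in> space M" for w
    using measurable_space[OF X that] by simp
  ultimately show ?thesis
    by (subst measurable_cong[OF sup_norm_sq_countable[OF _ T]])
qed

section \<open>Atomless Borel probability measures on Polish spaces\<close>

text \<open>With digits 0 and 1 in base 3, the first differing digit contributes 3^(-N), while all
  later ones together contribute at most 3^(-N) / 2. In base 2 the tail could cancel the leading
  difference.\<close>

lemma ternary_sum_inject:
  fixes a b :: "nat \<Rightarrow> bool"
  assumes eq: "(\<Sum>n. of_bool (a n) * (1/3)^n) = (\<Sum>n. of_bool (b n) * (1/3)^n :: real)"
  shows "a = b"
proof (rule ccontr)
  assume "a \<noteq> b"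
  then obtain m where "a m \<noteq> b m" by auto
  define N where "N = (LEAST m. a m \<noteq> b m)"
  have N: "a N \<noteq> b N" unfolding N_def by (rule LeastI[of _ m]) fact
  have low: "a i = b i" if "i < N" for i using not_less_Least[of i "\<lambda>m. a m \<noteq> b m"] that by (auto simp: N_def)
  define d where "d n = (of_bool (a n) - of_bool (b n)) * (1/3::real)^n" for n
  have geo: "summable (\<lambda>n. (1/3::real)^n)" by (intro summable_geometric) auto
  have sum1: "summable (\<lambda>n. of_bool (c n) * (1/3::real)^n)" for c :: "nat \<Rightarrow> bool"
    by (rule summable_comparison_test'[OF geo, of 0]) auto
  have sd: "summable d" unfolding d_def left_diff_distrib by (intro summable_diff sum1)
  have "suminf d = 0"
    unfolding d_def left_diff_distrib by (subst suminf_diff[symmetric]) (auto simp: sum1 eq)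
  moreover have "suminf d = (\<Sum>n. d (n + Suc N)) + (\<Sum>n<Suc N. d n)"
    by (rule suminf_split_initial_segment[OF sd])
  moreover have "(\<Sum>n<Suc N. d n) = d N"
    using low by (simp add: d_def)
  ultimately have "\<bar>d N\<bar> = \<bar>\<Sum>n. d (n + Suc N)\<bar>" by linarith
  also have "\<dots> \<le> (\<Sum>n. (1/3)^Suc N * (1/3)^n)"
  proof -
    have s2: "summable (\<lambda>n. (1/3::real)^Suc N * (1/3)^n)" by (intro summable_mult geo)
    have le: "\<bar>d (n + Suc N)\<bar> \<le> (1/3)^Suc N * (1/3)^n" for n
      by (auto simp: d_def power_add abs_mult)
    have s3: "summable (\<lambda>n. \<bar>d (n + Suc N)\<bar>)"
      using le by (intro summable_comparison_test'[OF s2, of 0]) auto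
    have "\<bar>\<Sum>n. d (n + Suc N)\<bar> \<le> (\<Sum>n. \<bar>d (n + Suc N)\<bar>)" by (rule summable_rabs[OF s3])
    also have "\<dots> \<le> (\<Sum>n. (1/3)^Suc N * (1/3)^n)" by (rule suminf_le[OF le s3 s2])
    finally show ?thesis .
  qed
  also have "\<dots> = (1/3)^Suc N * (3/2)"
    by (subst suminf_mult[OF geo]) (simp add: suminf_geometric)
  also have "\<dots> < (1/3)^N" by simp
  also have "\<dots> = \<bar>d N\<bar>" using N by (cases "a N"; cases "b N") (auto simp: d_def)
  finally show False by simp
qed

text \<open>In a T0 space a point is determined by the members of a countable basis that contain it;
  the ternary sum turns this sequence of truth values into one real number.\<close>

lemma borel_injection_real:
  "\<exists>h :: 'a::{second_countable_topology, t0_space} \<Rightarrow> real. inj h \<and> h \<in> borel_measurable borel"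
proof -
  obtain \<B> :: "'a set set" where \<B>: "countable \<B>" "topological_basis \<B>"
    using ex_countable_basis by blast
  define B where "B = from_nat_into \<B>"
  have ne: "\<B> \<noteq> {}"
    by (rule topological_basisE[OF \<B>(2) open_UNIV UNIV_I[of undefined]]) auto
  have op: "open (B n)" for n
    unfolding B_def by (rule topological_basis_open[OF \<B>(2) from_nat_into[OF ne]])
  define h :: "'a \<Rightarrow> real" where "h x = (\<Sum>n. of_bool (x \<in> B n) * (1/3)^n)" for x
  have "h \<in> borel_measurable borel"
  proof -
    have [measurable]: "B n \<in> sets borel" for n using op by simp
    have "h = (\<lambda>x. \<Sum>n. indicator (B n) x * (1/3)^n)"
      by (simp add: h_def fun_eq_iff indicator_def of_bool_def)
    also have "\<dots> \<in> borel_measurable borel" by measurable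
    finally show ?thesis .
  qed
  moreover have "inj h"
  proof (rule injI, rule ccontr)
    fix x y assume h: "h x = h y" and "x \<noteq> y"
    then obtain U where U: "open U" "x \<in> U \<longleftrightarrow> y \<notin> U" using separation_t0[of x y] by auto
    have mem: "x \<in> B n \<longleftrightarrow> y \<in> B n" for n
      using fun_cong[OF ternary_sum_inject[OF h[unfolded h_def]], of n] .
    have trans: "z' \<in> U" if z: "z \<in> U" and zz: "\<And>n. z \<in> B n \<longleftrightarrow> z' \<in> B n" for z z'
    proof -
      obtain C where C: "C \<in> \<B>" "z \<in> C" "C \<subseteq> U" by (rule topological_basisE[OF \<B>(2) U(1) z])
      obtain n where "C = B n" using from_nat_into_surj[OF \<B>(1) C(1)] unfolding B_def by metis
      then show ?thesis using C zz[of n] by auto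
    qed
    show False using U(2) trans[of x y] trans[of y x] mem by metis
  qed
  ultimately show ?thesis by blast
qed

lemma atomless_singleton:
  assumes "atomless P" "sets P = sets (borel :: 'a::t1_space measure)"
  shows "emeasure P {x} = 0"
proof (rule ccontr)
  assume "emeasure P {x} \<noteq> 0"
  then have "0 < emeasure P {x}" by (simp add: zero_less_iff_neq_zero)
  moreover have "{x} \<in> sets P" by (simp add: assms)
  ultimately obtain B where B: "B \<subseteq> {x}" "0 < emeasure P B" "emeasure P B < emeasure P {x}"
    using assms(1) unfolding atomless_def by blast
  then have "B = {} \<or> B = {x}" by auto
  then show False using B by auto
qed

text \<open>The intermediate value property of atomless measures. The restriction to
  \<open>A\<close> is pushed to the line by an injective \<open>h\<close>; point masses would come
  from singletons, so the distribution function is continuous and takes the value \<open>r\<close>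
  at some \<open>c\<close>. The set is then the part of \<open>A\<close> where \<open>h\<close> is
  at most \<open>c\<close>.\<close>

lemma atomless_subset_of_measure:
  fixes P :: "'a::polish_space measure"
  assumes P: "prob_space P" "sets P = sets borel" "atomless P"
    and A: "A \<in> sets P" and r: "0 < r" "r \<le> measure P A"
  shows "\<exists>B\<in>sets P. B \<subseteq> A \<and> measure P B = r"
\<comment> \<open>The full mass may be approached only as the argument tends to infinity, so it is
  treated apart.\<close>
proof (cases "r = measure P A")
  case False
  then have rA: "r < measure P A" using r by simp
  interpret prob_space P by fact
  obtain h :: "'a \<Rightarrow> real" where h: "inj h" "h \<in> borel_measurable borel"
    using borel_injection_real by blast
  have hP: "h \<in> borel_measurable P" using h(2) by (simp add: measurable_cong_sets[OF P(2) refl])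
  have spP: "space P = UNIV" using sets_eq_imp_space_eq[OF P(2)] by simp
  define R where "R = restrict_space P A"
  have hR: "h \<in> borel_measurable R" unfolding R_def by (rule measurable_restrict_space1[OF hP])
  define M where "M = distr R borel h"
  have spR: "space R = A" unfolding R_def by (simp add: space_restrict_space spP)
  have mR: "measure R B = measure P B" if "B \<subseteq> A" for B
    unfolding R_def using that A spP by (intro measure_restrict_space) auto
  have "finite_measure R" unfolding R_def by (rule finite_measure_restrict_space) (auto simp: A)
  then have "finite_measure M" unfolding M_def by (rule finite_measure.finite_measure_distr[OF _ hR])
  then interpret M: finite_borel_measure M
    by (intro finite_borel_measure.intro) (auto simp: M_def finite_borel_measure_axioms_def)
  have mM: "measure M B = measure P (h -` B \<inter> A)" if "B \<in> sets borel" for B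
    unfolding M_def using that by (subst measure_distr[OF hR]) (auto simp: spR intro!: mR)
  have zero: "measure M {c} = 0" for c
  proof -
    have "h -` {c} \<inter> A = {x}" if "h x = c" "x \<in> A" for x using that h(1) by (auto dest: injD)
    then have "h -` {c} \<inter> A = {} \<or> (\<exists>x. h -` {c} \<inter> A = {x})" by blast
    then show ?thesis
      unfolding mM[OF borel_singleton[OF sets.empty_sets]] using atomless_singleton[OF P(3) P(2)]
      by (auto simp: measure_def)
  qed
  have cont: "isCont (cdf M) c" for c using M.isCont_cdf zero by simp
  have tot: "measure M (space M) = measure P A" by (simp add: M.borel_UNIV mM)
  have "eventually (\<lambda>c. cdf M c < r) at_bot" using M.cdf_lim_at_bot r(1) by (rule order_tendstoD)
  then obtain u where u: "\<And>c. c \<le> u \<Longrightarrow> cdf M c < r" by (auto simp: eventually_at_bot_linorder)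
  have "eventually (\<lambda>c. cdf M c > r) at_top"
    using M.cdf_lim_at_top rA unfolding tot by (rule order_tendstoD)
  then obtain v where v: "\<And>c. c \<ge> v \<Longrightarrow> cdf M c > r" by (auto simp: eventually_at_top_linorder)
  \<comment> \<open>Taking \<open>min u v\<close> as the left end spares the proof that
    \<open>u\<close> lies below \<open>v\<close>.\<close>
  have "\<exists>c\<ge>min u v. c \<le> v \<and> cdf M c = r"
  proof (rule IVT)
    show "cdf M (min u v) \<le> r" using u[of "min u v"] by simp
    show "r \<le> cdf M v" using v[of v] by simp
    show "\<forall>c. min u v \<le> c \<and> c \<le> v \<longrightarrow> isCont (cdf M) c" using cont by blast
  qed simp
  then obtain c where c: "cdf M c = r" by blast
  have "measure P (h -` {..c} \<inter> A) = r" using c mM[of "{..c}"] by (simp add: cdf_def)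
  moreover have "h -` {..c} \<inter> A \<in> sets P"
    using measurable_sets[OF hP, of "{..c}"] A by (simp add: spP)
  ultimately show ?thesis by (intro bexI[of _ "h -` {..c} \<inter> A"]) simp_all
qed (intro bexI[of _ A], simp_all add: A)

lemma atomless_equal_measure_subsets:
  fixes P :: "'a::polish_space measure"
  assumes P: "prob_space P" "sets P = sets borel" "atomless P"
    and A: "A \<in> sets P" "0 < measure P A" and B: "B \<in> sets P" "0 < measure P B"
  shows "\<exists>A'\<in>sets P. \<exists>B'\<in>sets P. A' \<subseteq> A \<and> B' \<subseteq> B \<and> measure P A' = measure P B' \<and> 0 < measure P A'"
proof -
  define r where "r = min (measure P A) (measure P B)"
  obtain A' where "A' \<in> sets P" "A' \<subseteq> A" "measure P A' = r"
    using atomless_subset_of_measure[OF P A(1), of r] A B unfolding r_def by auto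
  moreover obtain B' where "B' \<in> sets P" "B' \<subseteq> B" "measure P B' = r"
    using atomless_subset_of_measure[OF P B(1), of r] A B unfolding r_def by auto
  moreover have "0 < r" using A B by (simp add: r_def)
  ultimately show ?thesis by (intro bexI[of _ A'] bexI[of _ B']) auto
qed

text \<open>Suppose \<open>g\<close> is below the mean \<open>k\<close> of \<open>g'\<close> on a
  part of \<open>A\<close> of positive probability. Either \<open>g'\<close> stays under a level
  below \<open>k\<close> almost everywhere on \<open>A'\<close>, which contradicts \<open>k\<close>
  being its mean, or there are two pieces of equal probability with different integrals, which
  contradicts \<open>eq\<close>.\<close>

lemma atomless_ge_mean:
  fixes P :: "'a::polish_space measure" and g g' :: "'a \<Rightarrow> real"
  assumes P: "prob_space P" "sets P = sets borel" "atomless P"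
    and A: "A \<in> sets P" "A' \<in> sets P" "measure P A = measure P A'" "0 < measure P A"
    and g: "integrable P g" "integrable P g'"
    and eq: "\<And>B B'. B \<in> sets P \<Longrightarrow> B' \<in> sets P \<Longrightarrow> B \<subseteq> A \<Longrightarrow> B' \<subseteq> A' \<Longrightarrow> measure P B = measure P B' \<Longrightarrow>
       (\<integral>w. indicator B w * g w \<partial>P) = (\<integral>w. indicator B' w * g' w \<partial>P)"
  shows "AE w in P. w \<in> A \<longrightarrow> (\<integral>w. indicator A' w * g' w \<partial>P) / measure P A' \<le> g w"
proof (rule ccontr)
  interpret prob_space P by fact
  define k where "k = (\<integral>w. indicator A' w * g' w \<partial>P) / measure P A'"
  have [measurable]: "A \<in> sets P" "A' \<in> sets P" "g \<in> borel_measurable P" "g' \<in> borel_measurable P"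
    using A g by auto
  have pos: "0 < measure P {w\<in>space P. Q w}" if "\<not> (AE w in P. \<not> Q w)" "{w\<in>space P. Q w} \<in> sets P" for Q
  proof (rule ccontr)
    assume "\<not> 0 < measure P {w\<in>space P. Q w}"
    then have "measure P {w\<in>space P. Q w} = 0" by (simp add: zero_less_measure_iff)
    then have "{w\<in>space P. Q w} \<in> null_sets P" using that(2) by (simp add: null_sets_def emeasure_eq_measure)
    from AE_not_in[OF this] AE_space have "AE w in P. \<not> Q w" by eventually_elim simp
    then show False using that(1) by blast
  qed
  have int: "integrable P (\<lambda>w. indicator D w * u w)" if "D \<in> sets P" "integrable P u" for D and u :: "'a \<Rightarrow> real"
    using integrable_real_mult_indicator[OF that] by (simp add: mult.commute)
  assume "\<not> (AE w in P. w \<in> A \<longrightarrow> (\<integral>w. indicator A' w * g' w \<partial>P) / measure P A' \<le> g w)"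
  \<comment> \<open>Countable additivity provides a fixed gap: \<open>g\<close> is below
    \<open>k\<close> by at least \<open>1 / Suc n\<close> with positive probability for some
    \<open>n\<close>.\<close>
  then have "\<not> (AE w in P. \<forall>n. w \<in> A \<longrightarrow> k - 1 / real (Suc n) < g w)"
  proof (rule contrapos_nn)
    assume "AE w in P. \<forall>n. w \<in> A \<longrightarrow> k - 1 / real (Suc n) < g w"
    then show "AE w in P. w \<in> A \<longrightarrow> (\<integral>w. indicator A' w * g' w \<partial>P) / measure P A' \<le> g w"
      unfolding k_def[symmetric]
    proof eventually_elim
      case (elim w)
      have "k \<le> g w" if "w \<in> A"
      proof (rule LIMSEQ_le_const2)
        show "(\<lambda>n. k - 1 / real (Suc n)) \<longlonglongrightarrow> k"
          using tendsto_diff[OF tendsto_const LIMSEQ_Suc[OF lim_const_over_n[of 1]], of k] by simp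
        show "\<exists>N. \<forall>n\<ge>N. k - 1 / real (Suc n) \<le> g w" using elim that less_imp_le by blast
      qed
      then show ?case by simp
    qed
  qed
  then obtain n where n: "\<not> (AE w in P. w \<in> A \<longrightarrow> k - 1 / real (Suc n) < g w)"
    unfolding AE_all_countable by blast
  define a where "a = k - 1 / real (Suc n)"
  \<comment> \<open>Two levels are used: \<open>a < b\<close> separates the integrals over the
    matched pieces, and \<open>b < k\<close> separates the mean from its bound.\<close>
  define b where "b = (a + k) / 2"
  have "a < k" by (simp add: a_def)
  then have ab: "a < b" "b < k" by (simp_all add: b_def)
  define B where "B = {w \<in> space P. w \<in> A \<and> g w \<le> a}"
  have Bm[measurable]: "B \<in> sets P" unfolding B_def by measurable
  have B0: "0 < measure P B"
    unfolding B_def using n Bm[unfolded B_def] by (intro pos) (auto simp: a_def not_le)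
  have up: "AE w in P. w \<in> A' \<longrightarrow> g' w \<le> b"
  proof (rule ccontr)
    assume na: "\<not> ?thesis"
    define C where "C = {w \<in> space P. w \<in> A' \<and> b < g' w}"
    have Cm[measurable]: "C \<in> sets P" unfolding C_def by measurable
    have C0: "0 < measure P C"
      unfolding C_def using na Cm[unfolded C_def] by (intro pos) (auto simp: not_less)
    obtain B' C' where BC: "B' \<in> sets P" "C' \<in> sets P" "B' \<subseteq> B" "C' \<subseteq> C"
      "measure P B' = measure P C'" "0 < measure P B'"
      using atomless_equal_measure_subsets[OF P Bm B0 Cm C0] by blast
    have "(\<integral>w. indicator B' w * g w \<partial>P) \<le> (\<integral>w. indicator B' w * a \<partial>P)"
      using BC by (intro integral_mono int g integrable_const) (auto simp: indicator_def B_def)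
    also have "\<dots> = a * measure P B'" using BC by simp
    also have "\<dots> < b * measure P B'" using ab BC by simp
    also have "\<dots> = (\<integral>w. indicator C' w * b \<partial>P)" using BC by simp
    also have "\<dots> \<le> (\<integral>w. indicator C' w * g' w \<partial>P)"
      using BC by (intro integral_mono int g integrable_const) (auto simp: indicator_def C_def)
    also have "\<dots> = (\<integral>w. indicator B' w * g w \<partial>P)"
    proof (rule eq[symmetric])
      show "B' \<subseteq> A" "C' \<subseteq> A'" using BC(3,4) by (auto simp: B_def C_def)
    qed (use BC in auto)
    finally show False by simp
  qed
  have "k * measure P A' = (\<integral>w. indicator A' w * g' w \<partial>P)" using A by (simp add: k_def)
  also have "\<dots> \<le> (\<integral>w. indicator A' w * b \<partial>P)"
    by (intro integral_mono_AE int g integrable_const A) (use up in \<open>auto simp: indicator_def\<close>)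
  also have "\<dots> = b * measure P A'" using A by simp
  also have "\<dots> < k * measure P A'" using ab A by simp
  finally show False by simp
qed

section \<open>Lifted functionals and their derivatives\<close>

text \<open>The one-sided bound is applied to the pair and to its negatives. Two sets and two
  functions occur so that the mean may come from one random variable and the constancy be concluded
  for another of the same law.\<close>

lemma atomless_eq_mean:
  fixes P :: "'a::polish_space measure" and g g' :: "'a \<Rightarrow> real"
  assumes P: "prob_space P" "sets P = sets borel" "atomless P"
    and A: "A \<in> sets P" "A' \<in> sets P" "measure P A = measure P A'" "0 < measure P A"
    and g: "integrable P g" "integrable P g'"
    and eq: "\<And>B B'. B \<in> sets P \<Longrightarrow> B' \<in> sets P \<Longrightarrow> B \<subseteq> A \<Longrightarrow> B' \<subseteq> A' \<Longrightarrow> measure P B = measure P B' \<Longrightarrow>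
       (\<integral>w. indicator B w * g w \<partial>P) = (\<integral>w. indicator B' w * g' w \<partial>P)"
  shows "AE w in P. w \<in> A \<longrightarrow> g w = (\<integral>w. indicator A' w * g' w \<partial>P) / measure P A'"
proof -
  have "AE w in P. w \<in> A \<longrightarrow> (\<integral>w. indicator A' w * g' w \<partial>P) / measure P A' \<le> g w"
    by (rule atomless_ge_mean[OF P A g eq])
  moreover have "AE w in P. w \<in> A \<longrightarrow> (\<integral>w. indicator A' w * - g' w \<partial>P) / measure P A' \<le> - g w"
    by (rule atomless_ge_mean[OF P A]) (use g eq in auto)
  ultimately show ?thesis by eventually_elim auto
qed

text \<open>A simple function below \<open>u\<close> pulls back along \<open>h\<close> to one below
  \<open>u \<circ> h\<close>. The inequality form admits integrands such as the square of
  \<open>dSK\<close>, whose measurability is not established here.\<close>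

lemma nn_integral_distr_le:
  assumes h: "h \<in> measurable M N"
  shows "(\<integral>\<^sup>+y. u y \<partial>distr M N h) \<le> (\<integral>\<^sup>+x. u (h x) \<partial>M)"
  unfolding nn_integral_def[of "distr M N h"]
proof (rule SUP_least)
  fix g assume "g \<in> {g. simple_function (distr M N h) g \<and> g \<le> u}"
  then have g: "simple_function (distr M N h) g" "g \<le> u" by auto
  have "integral\<^sup>S (distr M N h) g = (\<integral>\<^sup>+x. g (h x) \<partial>M)"
    using nn_integral_eq_simple_integral[OF g(1)] nn_integral_distr[OF h borel_measurable_simple_function[OF g(1)]] by simp
  also have "\<dots> \<le> (\<integral>\<^sup>+x. u (h x) \<partial>M)"
    using g(2) by (intro nn_integral_mono) (auto simp: le_fun_def)
  finally show "integral\<^sup>S (distr M N h) g \<le> (\<integral>\<^sup>+x. u (h x) \<partial>M)" .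
qed

text \<open>The integrands \<open>u n\<close> need not be measurable: the nonnegative integral is a supremum over simple
  functions, and dominated convergence applies to nearly optimal ones.\<close>

lemma nn_integral_dominated_tendsto_0:
  assumes w: "w \<in> borel_measurable M" "(\<integral>\<^sup>+x. w x \<partial>M) < \<infinity>"
    and le: "\<And>n x. x \<in> space M \<Longrightarrow> u n x \<le> w x"
    and lim: "\<And>x. x \<in> space M \<Longrightarrow> (\<lambda>n. u n x) \<longlonglongrightarrow> (0::ennreal)"
  shows "(\<lambda>n. \<integral>\<^sup>+x. u n x \<partial>M) \<longlonglongrightarrow> 0"
proof -
  have fin: "(\<integral>\<^sup>+x. u n x \<partial>M) < \<infinity>" for n
    using nn_integral_mono[of M "u n" w] le w(2) by (auto intro: le_less_trans)
  have "\<exists>g. simple_function M g \<and> g \<le> u n \<and> (\<integral>\<^sup>+x. u n x \<partial>M) \<le> (\<integral>\<^sup>+x. g x \<partial>M) + ennreal (1 / real (Suc n))" for n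
  \<comment> \<open>A simple function beating the integral minus \<open>1 / Suc n\<close> requires
    that difference to be strictly smaller than the integral, which fails when the integral is
    0.\<close>
  proof (cases "(\<integral>\<^sup>+x. u n x \<partial>M) = 0")
    case True
    then show ?thesis by (intro exI[of _ "\<lambda>_. 0"]) (auto simp: le_fun_def)
  next
    case False
    let ?I = "\<integral>\<^sup>+x. u n x \<partial>M"
    have "?I - ennreal (1 / real (Suc n)) < ?I"
      using False fin[of n] by (intro ennreal_between) (auto simp: zero_less_iff_neq_zero)
    then obtain g where g: "simple_function M g" "g \<le> u n" "?I - ennreal (1 / real (Suc n)) < integral\<^sup>S M g"
      unfolding nn_integral_def[of M "u n"] less_SUP_iff by auto
    have "?I \<le> (\<integral>\<^sup>+x. g x \<partial>M) + ennreal (1 / real (Suc n))"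
      using g(3) nn_integral_eq_simple_integral[OF g(1)]
      by (metis add.commute ennreal_minus_le_iff fin infinity_ennreal_def less_imp_le)
    then show ?thesis using g by blast
  qed
  then obtain g where g: "\<And>n. simple_function M (g n)" "\<And>n. g n \<le> u n"
    "\<And>n. (\<integral>\<^sup>+x. u n x \<partial>M) \<le> (\<integral>\<^sup>+x. g n x \<partial>M) + ennreal (1 / real (Suc n))"
    by metis
  have "(\<lambda>n. \<integral>\<^sup>+x. g n x \<partial>M) \<longlonglongrightarrow> (\<integral>\<^sup>+x. 0 \<partial>M)"
  proof (rule nn_integral_dominated_convergence[where w=w])
    show "AE x in M. g n x \<le> w x" for n
      using g(2)[of n] le[of _ n] by (intro AE_I2) (auto simp: le_fun_def intro: order_trans)
    show "AE x in M. (\<lambda>n. g n x) \<longlonglongrightarrow> 0"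
    proof (rule AE_I2)
      fix x assume "x \<in> space M"
      from lim[OF this] show "(\<lambda>n. g n x) \<longlonglongrightarrow> 0"
        by (rule tendsto_sandwich[OF _ _ tendsto_const, rotated 2]) (use g(2) in \<open>auto simp: le_fun_def\<close>)
    qed
  qed (use g w in \<open>auto intro: borel_measurable_simple_function\<close>)
  moreover have "(\<lambda>n. ennreal (1 / real (Suc n))) \<longlonglongrightarrow> 0"
    using tendsto_ennrealI[OF LIMSEQ_Suc[OF lim_const_over_n[of 1]]] by simp
  ultimately have "(\<lambda>n. (\<integral>\<^sup>+x. g n x \<partial>M) + ennreal (1 / real (Suc n))) \<longlonglongrightarrow> 0"
    using tendsto_add by fastforce
  then show ?thesis
    by (rule tendsto_sandwich[OF _ _ tendsto_const, rotated 2]) (use g(3) in auto)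
qed

section \<open>Square integrable random paths\<close>

lemma obtain_sup_norm:
  fixes x :: "real \<Rightarrow> real^'d::finite"
  assumes x: "x \<in> cadlag_paths T" and T: "0 \<le> T"
  obtains M where "0 \<le> M" "\<And>s. s \<in> {0..T} \<Longrightarrow> norm (x s) \<le> M"
    "(SUP s\<in>{0..T}. ennreal ((norm (x s))\<^sup>2)) = ennreal (M\<^sup>2)"
proof -
  let ?S = "SUP s\<in>{0..T}. ennreal ((norm (x s))\<^sup>2)"
  obtain K where K: "\<And>s. norm (x s) \<le> K" using cadlag_obtain_bound[OF x T] by metis
  have "?S \<le> ennreal (K\<^sup>2)"
    using K by (intro SUP_least ennreal_leI power_mono) auto
  then have "?S < top" using ennreal_less_top le_less_trans by blast
  then obtain m where m: "0 \<le> m" "?S = ennreal m" by (cases ?S) auto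
  have "norm (x s) \<le> sqrt m" if "s \<in> {0..T}" for s
  proof (rule real_le_rsqrt)
    have "ennreal ((norm (x s))\<^sup>2) \<le> ?S" by (rule SUP_upper[OF that])
    then show "(norm (x s))\<^sup>2 \<le> m" using m by (simp add: ennreal_le_iff)
  qed
  then show ?thesis using m by (intro that[of "sqrt m"]) auto
qed

text \<open>From (M + g)^2 \<le> 2 M^2 + 2 g^2. The assumption \<open>le\<close> speaks of every
  bound \<open>M\<close> of the path, so it can be used with the one whose square is the supremum.
  It serves perturbation, stopping and discretisation, with \<open>g\<close> the norm of the
  direction, 0 and \<open>CARD('d)\<close>.\<close>

lemma L2_paths_dominated:
  fixes X Y :: "'a \<Rightarrow> real \<Rightarrow> real^'d::finite"
  assumes T: "0 \<le> T" and X: "X \<in> L2_paths T P" and Y: "Y \<in> measurable P (path_space T)"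
    and g: "g \<in> borel_measurable P" "integrable P (\<lambda>w. (g w)\<^sup>2)"
    and le: "\<And>w M s. w \<in> space P \<Longrightarrow> (\<And>s. s \<in> {0..T} \<Longrightarrow> norm (X w s) \<le> M) \<Longrightarrow> s \<in> {0..T} \<Longrightarrow> norm (Y w s) \<le> M + g w"
  shows "Y \<in> L2_paths T P"
proof -
  have Xm: "X \<in> measurable P (path_space T)" using X by (simp add: L2_paths_def)
  let ?S = "\<lambda>Z w. SUP s\<in>{0..T}. ennreal ((norm (Z w s :: real^'d))\<^sup>2)"
  have "?S Y w \<le> 2 * ?S X w + 2 * ennreal ((g w)\<^sup>2)" if w: "w \<in> space P" for w
  proof -
    have "X w \<in> cadlag_paths T" using measurable_space[OF Xm w] by simp
    then obtain M where M: "0 \<le> M" "\<And>s. s \<in> {0..T} \<Longrightarrow> norm (X w s) \<le> M" "?S X w = ennreal (M\<^sup>2)"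
      using obtain_sup_norm[OF _ T] by metis
    have "ennreal ((norm (Y w s))\<^sup>2) \<le> ennreal (2 * M\<^sup>2 + 2 * (g w)\<^sup>2)" if s: "s \<in> {0..T}" for s
    proof (rule ennreal_leI)
      have "(norm (Y w s))\<^sup>2 \<le> (M + g w)\<^sup>2" using le[OF w M(2) s] by (intro power_mono) auto
      also have "\<dots> \<le> 2 * M\<^sup>2 + 2 * (g w)\<^sup>2"
        using zero_le_power2[of "M - g w"] by (simp add: power2_eq_square algebra_simps)
      finally show "(norm (Y w s))\<^sup>2 \<le> 2 * M\<^sup>2 + 2 * (g w)\<^sup>2" .
    qed
    then have "?S Y w \<le> ennreal (2 * M\<^sup>2 + 2 * (g w)\<^sup>2)" by (rule SUP_least)
    also have "\<dots> = 2 * ?S X w + 2 * ennreal ((g w)\<^sup>2)"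
      unfolding M(3) by (simp add: ennreal_plus ennreal_mult)
    finally show ?thesis .
  qed
  then have "(\<integral>\<^sup>+w. ?S Y w \<partial>P) \<le> (\<integral>\<^sup>+w. 2 * ?S X w + 2 * ennreal ((g w)\<^sup>2) \<partial>P)"
    by (rule nn_integral_mono)
  also have "\<dots> = 2 * (\<integral>\<^sup>+w. ?S X w \<partial>P) + 2 * (\<integral>\<^sup>+w. ennreal ((g w)\<^sup>2) \<partial>P)"
    using measurable_sup_norm_sq[OF T Xm] g(1) by (simp add: nn_integral_add nn_integral_cmult)
  also have "\<dots> < \<infinity>"
  proof -
    have "(\<integral>\<^sup>+w. ?S X w \<partial>P) < \<infinity>" using X by (simp add: L2_paths_def)
    moreover have "(\<integral>\<^sup>+w. ennreal ((g w)\<^sup>2) \<partial>P) < \<infinity>"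
      using g(2) by (subst nn_integral_eq_integral) auto
    ultimately show ?thesis by (simp add: ennreal_mult_less_top)
  qed
  finally show ?thesis using Y by (simp add: L2_paths_def)
qed

lemma perturb_L2_paths:
  fixes X :: "'a \<Rightarrow> real \<Rightarrow> real^'d::finite"
  assumes t: "t \<in> {0..T}" and X: "X \<in> L2_paths T P" and \<xi>: "\<xi> \<in> L2_vec P"
  shows "perturb T t X \<xi> \<in> L2_paths T P"
proof (rule L2_paths_dominated[OF _ X, where g="\<lambda>w. norm (\<xi> w)"])
  have T: "0 \<le> T" using t by auto
  have Xm: "X \<in> measurable P (path_space T)" using X by (simp add: L2_paths_def)
  have [measurable]: "\<xi> \<in> borel_measurable P" using \<xi> by (simp add: L2_vec_def)
  note [measurable] = measurable_path_space_eval[OF T Xm]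
  show "perturb T t X \<xi> \<in> measurable P (path_space T)"
    unfolding path_space_def
  proof (rule measurable_path_filtI)
    fix w assume "w \<in> space P"
    then have "X w \<in> cadlag_paths T" using measurable_space[OF Xm] by auto
    from jump_cadlag[OF this t] show "perturb T t X \<xi> w \<in> cadlag_paths T" by (simp add: perturb_def)
  next
    fix s
    show "(\<lambda>w. perturb T t X \<xi> w s) \<in> borel_measurable P"
      unfolding perturb_def by measurable
  qed
  fix w M s assume "\<And>s. s \<in> {0..T} \<Longrightarrow> norm (X w s) \<le> M" "s \<in> {0..T}"
  then have "norm (X w s) \<le> M" by blast
  then show "norm (perturb T t X \<xi> w s) \<le> M + norm (\<xi> w)"
    using norm_triangle_ineq[of "X w s" "\<xi> w"] norm_ge_zero[of "\<xi> w"]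
    unfolding perturb_def by (cases "s \<in> {t..T}") (simp_all add: add_increasing2 del: norm_ge_zero)
qed (use t \<xi> in \<open>auto simp: L2_vec_def\<close>)

lemma stopped_L2_paths:
  fixes X :: "'a \<Rightarrow> real \<Rightarrow> real^'d::finite"
  assumes t: "t \<in> {0..T}" and X: "X \<in> L2_paths T P"
  shows "(\<lambda>w. stopped T t (X w)) \<in> L2_paths T P"
proof (rule L2_paths_dominated[OF _ X, where g="\<lambda>w. 0"])
  have Xm: "X \<in> measurable P (path_space T)" using X by (simp add: L2_paths_def)
  show "(\<lambda>w. stopped T t (X w)) \<in> measurable P (path_space T)"
    using measurable_compose[OF measurable_compose[OF Xm path_filt_mono[of t]] measurable_stopped[OF t]] t by simp
  fix w M s assume M: "\<And>s. s \<in> {0..T} \<Longrightarrow> norm (X w s) \<le> M" and s: "s \<in> {0..T}"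
  have "norm (X w (min t s)) \<le> M" using s t by (intro M) auto
  then show "norm (stopped T t (X w) s) \<le> M + 0" using s by (simp add: stopped_def)
qed (use t in auto)

section \<open>Continuity of \<open>f\<close> and stopped laws\<close>

lemma law_P2:
  assumes "prob_space P" "X \<in> L2_paths T P"
  shows "distr P (path_space T) X \<in> P2 T"
proof -
  have X: "X \<in> measurable P (path_space T)" using assms by (simp add: L2_paths_def)
  have "(\<integral>\<^sup>+\<omega>. (SUP s\<in>{0..T}. ennreal ((norm (\<omega> s))\<^sup>2)) \<partial>distr P (path_space T) X)
     \<le> (\<integral>\<^sup>+w. (SUP s\<in>{0..T}. ennreal ((norm (X w s))\<^sup>2)) \<partial>P)"
    by (rule nn_integral_distr_le[OF X])
  also have "\<dots> < \<infinity>" using assms(2) by (simp add: L2_paths_def)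
  finally show ?thesis
    using prob_space.prob_space_distr[OF assms(1) X] by (simp add: P2_def)
qed

text \<open>The diagonal coupling has cost 0.\<close>

lemma W2sq_self:
  fixes \<nu> :: "(real \<Rightarrow> real^'d::finite) measure"
  assumes T: "0 \<le> T" and \<nu>: "prob_space \<nu>" "sets \<nu> = sets (path_space T)"
  shows "W2sq T \<nu> \<nu> = 0"
proof -
  have dm: "(\<lambda>x. (x, x)) \<in> measurable \<nu> (path_space T \<Otimes>\<^sub>M path_space T)"
    by (intro measurable_Pair) (auto simp: measurable_ident_sets[OF \<nu>(2)])
  define Q where "Q = distr \<nu> (path_space T \<Otimes>\<^sub>M path_space T) (\<lambda>x. (x, x))"
  have sp: "space \<nu> = cadlag_paths T" using sets_eq_imp_space_eq[OF \<nu>(2)] by simp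
  have id: "distr \<nu> (path_space T) (\<lambda>x. x) = \<nu>" using \<nu>(2) by (intro distr_id2) simp
  have "Q \<in> couplings T \<nu> \<nu>"
    unfolding couplings_def Q_def
    using prob_space.prob_space_distr[OF \<nu>(1) dm]
    by (auto simp: distr_distr[OF measurable_fst dm] distr_distr[OF measurable_snd dm] comp_def id)
  then have "(INF P\<in>couplings T \<nu> \<nu>. \<integral>\<^sup>+ z. ennreal ((dSK T (fst z) (snd z))\<^sup>2) \<partial>P)
     \<le> (\<integral>\<^sup>+ z. ennreal ((dSK T (fst z) (snd z))\<^sup>2) \<partial>Q)" by (rule INF_lower)
  also have "\<dots> \<le> (\<integral>\<^sup>+ x. ennreal ((dSK T x x)\<^sup>2) \<partial>\<nu>)"
    unfolding Q_def using nn_integral_distr_le[OF dm, of "\<lambda>z. ennreal ((dSK T (fst z) (snd z))\<^sup>2)"] by simp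
  also have "\<dots> = (\<integral>\<^sup>+ x. 0 \<partial>\<nu>)"
    by (intro nn_integral_cong) (simp add: sp dSK_self[OF _ T])
  finally show ?thesis unfolding W2sq_def by simp
qed

text \<open>The two points have pseudodistance 0, so they satisfy the closeness condition for every
  \<open>\<epsilon>\<close>.\<close>

lemma Theta_continuous_stopped:
  fixes \<mu> \<mu>' :: "(real \<Rightarrow> real^'d::finite) measure"
  assumes t: "t \<in> {0..T}" and f: "Theta_continuous T f" and \<mu>: "\<mu> \<in> P2 T" "\<mu>' \<in> P2 T"
    and eq: "stopped_law T t \<mu> = stopped_law T t \<mu>'"
  shows "f t \<mu> = f t \<mu>'"
proof -
  have m: "stopped T t \<in> measurable \<mu> (path_space T)"
    using measurable_compose[OF path_filt_mono[of t T] measurable_stopped[OF t]] t \<mu>(1)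
    by (simp add: P2_def cong: measurable_cong_sets)
  have "W2sq T (stopped_law T t \<mu>) (stopped_law T t \<mu>) = 0"
    using \<mu>(1) t m unfolding stopped_law_def
    by (intro W2sq_self) (auto simp: P2_def intro: prob_space.prob_space_distr)
  then have z: "Theta_dist T t \<mu> t \<mu>' = 0" by (simp add: Theta_dist_def flip: eq)
  have "\<bar>f t \<mu> - f t \<mu>'\<bar> < \<epsilon>" if "0 < \<epsilon>" for \<epsilon>
    using f t \<mu> that z unfolding Theta_continuous_def by metis
  from this[of "\<bar>f t \<mu> - f t \<mu>'\<bar>"] show ?thesis by linarith
qed

lemma lift_cong_stopped:
  fixes X X' :: "'a \<Rightarrow> real \<Rightarrow> real^'d::finite"
  assumes t: "t \<in> {0..T}" and f: "Theta_continuous T f" and P: "prob_space P"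
    and X: "X \<in> L2_paths T P" "X' \<in> L2_paths T P"
    and eq: "\<And>w. stopped T t (X w) = stopped T t (X' w)"
  shows "lift T P f t X = lift T P f t X'"
  unfolding lift_def
proof (rule Theta_continuous_stopped[OF t f law_P2[OF P X(1)] law_P2[OF P X(2)]])
  have m: "stopped T t \<in> measurable (path_space T) (path_space T :: (real \<Rightarrow> real^'d) measure)"
    using measurable_compose[OF path_filt_mono[of t T] measurable_stopped[OF t]] t by simp
  have "X \<in> measurable P (path_space T)" "X' \<in> measurable P (path_space T)" using X by (simp_all add: L2_paths_def)
  then show "stopped_law T t (distr P (path_space T) X) = stopped_law T t (distr P (path_space T) X')"
    unfolding stopped_law_def by (simp add: distr_distr[OF m] comp_def eq)
qed

section \<open>Square integrable directions and comparison of derivatives\<close>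

lemma L2_norm_scaleR: "L2_norm P (\<lambda>w. e *\<^sub>R \<xi> w) = \<bar>e\<bar> * L2_norm P \<xi>"
  by (simp add: L2_norm_def power_mult_distrib real_sqrt_mult)

lemma L2_norm_nonneg: "0 \<le> L2_norm P \<xi>"
  by (simp add: L2_norm_def)

lemma L2_vec_scaleR: "\<xi> \<in> L2_vec P \<Longrightarrow> (\<lambda>w. e *\<^sub>R \<xi> w) \<in> L2_vec P"
  by (auto simp: L2_vec_def power_mult_distrib)

lemma L2_vec_indicator:
  assumes "prob_space P" "B \<in> sets P"
  shows "(\<lambda>w. indicator B w *\<^sub>R v) \<in> L2_vec P"
proof -
  interpret prob_space P by fact
  have "(\<lambda>w. (norm (indicator B w *\<^sub>R v))\<^sup>2) = (\<lambda>w. indicator B w * (norm v)\<^sup>2)"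
    by (auto simp: indicator_def)
  moreover have "integrable P (\<lambda>w. indicator B w * (norm v)\<^sup>2)"
    using assms by (intro integrable_mult_left integrable_real_indicator) (auto simp: emeasure_eq_measure)
  ultimately show ?thesis using assms(2) by (simp add: L2_vec_def)
qed

lemma L2_vec_diff:
  assumes "\<xi> \<in> L2_vec P" "\<eta> \<in> L2_vec P"
  shows "(\<lambda>w. \<xi> w - \<eta> w) \<in> L2_vec P"
proof -
  have [measurable]: "\<xi> \<in> borel_measurable P" "\<eta> \<in> borel_measurable P" using assms by (auto simp: L2_vec_def)
  have "integrable P (\<lambda>w. (norm (\<xi> w - \<eta> w))\<^sup>2)"
  proof (rule Bochner_Integration.integrable_bound)
    show "integrable P (\<lambda>w. 2 * (norm (\<xi> w))\<^sup>2 + 2 * (norm (\<eta> w))\<^sup>2)"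
      using assms by (simp add: L2_vec_def)
    show "AE w in P. norm ((norm (\<xi> w - \<eta> w))\<^sup>2) \<le> norm (2 * (norm (\<xi> w))\<^sup>2 + 2 * (norm (\<eta> w))\<^sup>2)"
    proof (rule AE_I2)
      fix w
      have "(norm (\<xi> w - \<eta> w))\<^sup>2 \<le> (norm (\<xi> w) + norm (\<eta> w))\<^sup>2"
        by (intro power_mono norm_triangle_ineq4) auto
      also have "\<dots> \<le> 2 * (norm (\<xi> w))\<^sup>2 + 2 * (norm (\<eta> w))\<^sup>2"
        using zero_le_power2[of "norm (\<xi> w) - norm (\<eta> w)"] by (simp add: power2_eq_square algebra_simps)
      finally show "norm ((norm (\<xi> w - \<eta> w))\<^sup>2) \<le> norm (2 * (norm (\<xi> w))\<^sup>2 + 2 * (norm (\<eta> w))\<^sup>2)" by simp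
    qed
  qed simp
  then show ?thesis by (simp add: L2_vec_def)
qed

lemma L2_vec_integrable:
  assumes "prob_space P" "\<xi> \<in> L2_vec P"
  shows "integrable P \<xi>"
proof (rule Bochner_Integration.integrable_bound)
  interpret prob_space P by fact
  show "integrable P (\<lambda>w. 1 + (norm (\<xi> w))\<^sup>2)" using assms(2) by (simp add: L2_vec_def)
  show "AE w in P. norm (\<xi> w) \<le> norm (1 + (norm (\<xi> w))\<^sup>2)"
  proof (rule AE_I2)
    fix w
    have "norm (\<xi> w) \<le> 1 + (norm (\<xi> w))\<^sup>2"
      using zero_le_power2[of "norm (\<xi> w) - 1"] norm_ge_zero[of "\<xi> w"]
      unfolding power2_diff by (simp del: norm_ge_zero)
    then show "norm (\<xi> w) \<le> norm (1 + (norm (\<xi> w))\<^sup>2)" by simp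
  qed
qed (use assms in \<open>simp add: L2_vec_def\<close>)

text \<open>If the lift takes the same values along two rays, the two directional derivatives agree.
  Base points and directions may both differ: one use changes only the base point, the other changes
  both.\<close>

lemma frechet_deriv_compare:
  fixes DF :: "('a \<Rightarrow> real \<Rightarrow> real^'d::finite) \<Rightarrow> ('a \<Rightarrow> real^'d)"
  assumes F: "frechet_deriv_lift T P f t DF"
    and X: "X \<in> L2_paths T P" "X' \<in> L2_paths T P" and \<xi>: "\<xi> \<in> L2_vec P" "\<xi>' \<in> L2_vec P"
    and eq0: "lift T P f t X = lift T P f t X'"
    and eq: "\<And>e. 0 < e \<Longrightarrow> lift T P f t (perturb T t X (\<lambda>w. e *\<^sub>R \<xi> w)) = lift T P f t (perturb T t X' (\<lambda>w. e *\<^sub>R \<xi>' w))"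
  shows "(\<integral>w. DF X w \<bullet> \<xi> w \<partial>P) = (\<integral>w. DF X' w \<bullet> \<xi>' w \<partial>P)"
proof (rule ccontr)
  let ?I = "\<integral>w. DF X w \<bullet> \<xi> w \<partial>P" and ?I' = "\<integral>w. DF X' w \<bullet> \<xi>' w \<partial>P"
  let ?N = "L2_norm P \<xi>" and ?N' = "L2_norm P \<xi>'"
  assume "?I \<noteq> ?I'"
  then have D: "0 < \<bar>?I - ?I'\<bar>" by simp
  have N: "0 \<le> ?N" "0 \<le> ?N'" by (rule L2_norm_nonneg)+
  \<comment> \<open>Chosen so that the two error terms, divided by \<open>e\<close>, add up to at
    most half of the supposed difference; the summand 1 keeps the denominator positive.\<close>
  define \<epsilon> where "\<epsilon> = \<bar>?I - ?I'\<bar> / (2 * (1 + ?N + ?N'))"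
  have \<epsilon>: "0 < \<epsilon>" unfolding \<epsilon>_def using D N by (intro divide_pos_pos) auto
  obtain \<delta> where \<delta>: "0 < \<delta>" "\<And>\<zeta>. \<zeta> \<in> L2_vec P \<Longrightarrow> L2_norm P \<zeta> < \<delta> \<Longrightarrow>
    \<bar>lift T P f t (perturb T t X \<zeta>) - lift T P f t X - (\<integral>w. DF X w \<bullet> \<zeta> w \<partial>P)\<bar> \<le> \<epsilon> * L2_norm P \<zeta>"
    using F X(1) \<epsilon> unfolding frechet_deriv_lift_def by blast
  obtain \<delta>' where \<delta>': "0 < \<delta>'" "\<And>\<zeta>. \<zeta> \<in> L2_vec P \<Longrightarrow> L2_norm P \<zeta> < \<delta>' \<Longrightarrow>
    \<bar>lift T P f t (perturb T t X' \<zeta>) - lift T P f t X' - (\<integral>w. DF X' w \<bullet> \<zeta> w \<partial>P)\<bar> \<le> \<epsilon> * L2_norm P \<zeta>"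
    using F X(2) \<epsilon> unfolding frechet_deriv_lift_def by blast
  define e where "e = min \<delta> \<delta>' / (1 + ?N + ?N')"
  have e: "0 < e" unfolding e_def using \<delta>(1) \<delta>'(1) N by (intro divide_pos_pos) auto
  have eN: "e * (1 + ?N + ?N') = min \<delta> \<delta>'" unfolding e_def using N by simp
  have "e * ?N < e * (1 + ?N + ?N')" "e * ?N' < e * (1 + ?N + ?N')"
    using e N by (auto intro!: mult_strict_left_mono)
  then have small: "e * ?N < \<delta>" "e * ?N' < \<delta>'" unfolding eN by auto
  have 1: "\<bar>lift T P f t (perturb T t X (\<lambda>w. e *\<^sub>R \<xi> w)) - lift T P f t X - e * ?I\<bar> \<le> \<epsilon> * (e * ?N)"
    using \<delta>(2)[OF L2_vec_scaleR[OF \<xi>(1)], of e] small(1) e by (simp add: L2_norm_scaleR)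
  have 2: "\<bar>lift T P f t (perturb T t X' (\<lambda>w. e *\<^sub>R \<xi>' w)) - lift T P f t X' - e * ?I'\<bar> \<le> \<epsilon> * (e * ?N')"
    using \<delta>'(2)[OF L2_vec_scaleR[OF \<xi>(2)], of e] small(2) e by (simp add: L2_norm_scaleR)
  have "\<bar>e * ?I - e * ?I'\<bar> \<le> \<epsilon> * (e * ?N) + \<epsilon> * (e * ?N')"
    using 1 2 unfolding eq[OF e] eq0 by linarith
  also have "\<dots> = e * (\<epsilon> * (?N + ?N'))" by (simp add: algebra_simps)
  finally have "e * \<bar>?I - ?I'\<bar> \<le> e * (\<epsilon> * (?N + ?N'))"
    using e by (simp add: abs_mult flip: right_diff_distrib)
  then have "\<bar>?I - ?I'\<bar> \<le> \<epsilon> * (?N + ?N')" using e by simp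
  also have "\<dots> \<le> \<epsilon> * (1 + ?N + ?N')" using \<epsilon> by (intro mult_left_mono) auto
  also have "\<dots> = \<bar>?I - ?I'\<bar> / 2" unfolding \<epsilon>_def using N by (simp add: field_simps)
  finally show False using D by simp
qed

text \<open>The test direction is the difference of the two derivatives itself, so equality of the
  directional derivatives says that its square has integral 0.\<close>

lemma DF_stopped:
  fixes DF :: "('a \<Rightarrow> real \<Rightarrow> real^'d::finite) \<Rightarrow> ('a \<Rightarrow> real^'d)"
  assumes t: "t \<in> {0..T}" and f: "Theta_continuous T f" and P: "prob_space P"
    and F: "frechet_deriv_lift T P f t DF" and X: "X \<in> L2_paths T P"
  shows "AE w in P. DF X w = DF (\<lambda>w. stopped T t (X w)) w"
proof -
  let ?Z = "\<lambda>w. stopped T t (X w)"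
  let ?\<xi> = "\<lambda>w. DF X w - DF ?Z w"
  have Z: "?Z \<in> L2_paths T P" by (rule stopped_L2_paths[OF t X])
  have D: "DF X \<in> L2_vec P" "DF ?Z \<in> L2_vec P"
    using F X Z unfolding frechet_deriv_lift_def by blast+
  have \<xi>: "?\<xi> \<in> L2_vec P" by (rule L2_vec_diff[OF D])
  have "(\<integral>w. DF X w \<bullet> ?\<xi> w \<partial>P) = (\<integral>w. DF ?Z w \<bullet> ?\<xi> w \<partial>P)"
  proof (rule frechet_deriv_compare[OF F X Z \<xi> \<xi>])
    show "lift T P f t X = lift T P f t ?Z"
      using t by (intro lift_cong_stopped[OF t f P X Z]) (auto simp: stopped_def fun_eq_iff min_def)
    fix e :: real assume "0 < e"
    \<comment> \<open>A jump starting at \<open>t\<close> is already complete in the value at time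
      \<open>t\<close>, so stopping at \<open>t\<close> makes the two perturbed paths equal.\<close>
    show "lift T P f t (perturb T t X (\<lambda>w. e *\<^sub>R ?\<xi> w)) = lift T P f t (perturb T t ?Z (\<lambda>w. e *\<^sub>R ?\<xi> w))"
      using t by (intro lift_cong_stopped[OF t f P] perturb_L2_paths[OF t] X Z L2_vec_scaleR[OF \<xi>])
        (auto simp: stopped_def perturb_def fun_eq_iff min_def)
  qed
  moreover have int: "integrable P (\<lambda>w. \<eta> w \<bullet> ?\<xi> w)" if \<eta>: "\<eta> \<in> L2_vec P" for \<eta>
  proof (rule Bochner_Integration.integrable_bound)
    show "integrable P (\<lambda>w. (norm (\<eta> w))\<^sup>2 + (norm (?\<xi> w))\<^sup>2)"
      using \<eta> \<xi> by (simp add: L2_vec_def)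
    show "(\<lambda>w. \<eta> w \<bullet> ?\<xi> w) \<in> borel_measurable P"
      using \<eta> \<xi> by (intro borel_measurable_inner) (auto simp: L2_vec_def)
    show "AE w in P. norm (\<eta> w \<bullet> ?\<xi> w) \<le> norm ((norm (\<eta> w))\<^sup>2 + (norm (?\<xi> w))\<^sup>2)"
    proof (rule AE_I2)
      fix w
      have "\<bar>\<eta> w \<bullet> ?\<xi> w\<bar> \<le> norm (\<eta> w) * norm (?\<xi> w)" by (rule Cauchy_Schwarz_ineq2)
      also have "\<dots> \<le> (norm (\<eta> w))\<^sup>2 + (norm (?\<xi> w))\<^sup>2"
        using zero_le_power2[of "norm (\<eta> w) - norm (?\<xi> w)"] mult_nonneg_nonneg[OF norm_ge_zero[of "\<eta> w"] norm_ge_zero[of "?\<xi> w"]]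
        unfolding power2_diff by linarith
      finally show "norm (\<eta> w \<bullet> ?\<xi> w) \<le> norm ((norm (\<eta> w))\<^sup>2 + (norm (?\<xi> w))\<^sup>2)" by simp
    qed
  qed
  ultimately have "(\<integral>w. ?\<xi> w \<bullet> ?\<xi> w \<partial>P) = 0"
    using int[OF D(1)] int[OF D(2)] by (simp add: inner_diff_left)
  then have "AE w in P. ?\<xi> w \<bullet> ?\<xi> w = 0"
    by (subst (asm) integral_nonneg_eq_0_iff_AE[OF int[OF \<xi>]]) auto
  then show ?thesis by eventually_elim simp
qed

text \<open>The perturbation moves the mass of \<open>B\<close> from the single path
  \<open>c\<close> to the single path with the jump. The result depends on \<open>Y\<close> only
  through its law and on \<open>B\<close> only through its probability.\<close>

lemma measure_perturb_constant_piece: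
  fixes Y :: "'a \<Rightarrow> real \<Rightarrow> real^'d::finite"
  assumes t: "t \<in> {0..T}" and P: "prob_space P" and Y: "Y \<in> L2_paths T P"
    and B: "B \<in> sets P" "\<And>w. w \<in> B \<Longrightarrow> Y w = c" and S: "S \<in> sets (path_space T)"
  shows "measure P (perturb T t Y (\<lambda>w. indicator B w *\<^sub>R v) -` S \<inter> space P)
    = measure (distr P (path_space T) Y) S - (if c \<in> S then measure P B else 0)
      + (if (\<lambda>s. c s + (if s \<in> {t..T} then v else 0)) \<in> S then measure P B else 0)"
proof -
  interpret prob_space P by fact
  let ?Z = "perturb T t Y (\<lambda>w. indicator B w *\<^sub>R v)"
  let ?d = "\<lambda>s. c s + (if s \<in> {t..T} then v else 0)"
  have Ym: "Y \<in> measurable P (path_space T)" using Y by (simp add: L2_paths_def)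
  have BP: "B \<subseteq> space P" using B(1) by (rule sets.sets_into_space)
  have YS: "Y -` S \<inter> space P \<in> sets P" using Ym S by (rule measurable_sets)
  have on: "?Z w = ?d" if "w \<in> B" for w using that B(2)[OF that] by (auto simp: perturb_def fun_eq_iff)
  have off: "?Z w = Y w" if "w \<notin> B" for w using that by (simp add: perturb_def fun_eq_iff)
  have "?Z -` S \<inter> space P = ((Y -` S \<inter> space P) - B) \<union> (if ?d \<in> S then B else {})"
  proof (rule set_eqI)
    fix w
    show "w \<in> ?Z -` S \<inter> space P \<longleftrightarrow> w \<in> ((Y -` S \<inter> space P) - B) \<union> (if ?d \<in> S then B else {})"
    proof (cases "w \<in> B")
      case True
      then show ?thesis using BP unfolding vimage_def mem_Collect_eq Int_iff on[OF True] by auto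
    next
      case False
      then show ?thesis unfolding vimage_def mem_Collect_eq Int_iff off[OF False] by auto
    qed
  qed
  then have "measure P (?Z -` S \<inter> space P) = measure P ((Y -` S \<inter> space P) - B) + measure P (if ?d \<in> S then B else {})"
    using YS B(1) by (simp only:, intro finite_measure_Union) auto
  moreover have "measure P ((Y -` S \<inter> space P) - B) = measure P (Y -` S \<inter> space P) - measure P (if c \<in> S then B else {})"
  proof -
    have "(Y -` S \<inter> space P) \<inter> B = (if c \<in> S then B else {})" using B(2) BP by auto
    then show ?thesis using finite_measure_Diff'[OF YS B(1)] by simp
  qed
  ultimately show ?thesis using measure_distr[OF Ym S] by simp
qed

text \<open>For \<open>B\<close> in \<open>A\<close> and \<open>B'\<close> in \<open>A'\<close> of
  equal probability the perturbed variables have equal laws along the whole ray, so the derivatives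
  have equal integrals over them. The mean principle then gives constancy on \<open>A'\<close>, with
  the value computed from \<open>Y\<close> on \<open>A\<close>.\<close>

lemma DF_constant_piece:
  fixes P :: "'a::polish_space measure"
    and DF :: "('a \<Rightarrow> real \<Rightarrow> real^'d::finite) \<Rightarrow> ('a \<Rightarrow> real^'d)"
  assumes t: "t \<in> {0..T}" and P: "prob_space P" "sets P = sets borel" "atomless P"
    and F: "frechet_deriv_lift T P f t DF"
    and Y: "Y \<in> L2_paths T P" "Y' \<in> L2_paths T P"
    and law: "distr P (path_space T) Y' = distr P (path_space T) Y"
    and A: "A \<in> sets P" "A' \<in> sets P" "measure P A' = measure P A"
    and c: "\<And>w. w \<in> A \<Longrightarrow> Y w = c" "\<And>w. w \<in> A' \<Longrightarrow> Y' w = c"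
  shows "AE w in P. w \<in> A' \<longrightarrow> DF Y' w = (1 / measure P A) *\<^sub>R (\<integral>w. indicator A w *\<^sub>R DF Y w \<partial>P)"
proof (cases "measure P A = 0")
  case True
  interpret prob_space P by fact
  have "A' \<in> null_sets P" using True A by (simp add: null_sets_def emeasure_eq_measure)
  from AE_not_in[OF this] show ?thesis by eventually_elim simp
next
  case False
  interpret prob_space P by fact
  have pos: "0 < measure P A'" using False A(3) by (simp add: zero_less_measure_iff)
  have D: "DF Y \<in> L2_vec P" "DF Y' \<in> L2_vec P"
    using F Y unfolding frechet_deriv_lift_def by blast+
  note int = L2_vec_integrable[OF P(1) D(1)] L2_vec_integrable[OF P(1) D(2)]
  let ?k = "(1 / measure P A) *\<^sub>R (\<integral>w. indicator A w *\<^sub>R DF Y w \<partial>P)"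
  have "AE w in P. w \<in> A' \<longrightarrow> DF Y' w \<bullet> v = ?k \<bullet> v" for v
  proof -
    have "AE w in P. w \<in> A' \<longrightarrow> DF Y' w \<bullet> v = (\<integral>w. indicator A w * (DF Y w \<bullet> v) \<partial>P) / measure P A"
    proof (rule atomless_eq_mean[OF P A(2,1,3) pos])
      show "integrable P (\<lambda>w. DF Y' w \<bullet> v)" "integrable P (\<lambda>w. DF Y w \<bullet> v)"
        using int by auto
      fix B' B assume B: "B' \<in> sets P" "B \<in> sets P" "B' \<subseteq> A'" "B \<subseteq> A" "measure P B' = measure P B"
      have "(\<integral>w. DF Y' w \<bullet> (indicator B' w *\<^sub>R v) \<partial>P) = (\<integral>w. DF Y w \<bullet> (indicator B w *\<^sub>R v) \<partial>P)"
      proof (rule frechet_deriv_compare[OF F Y(2,1) L2_vec_indicator[OF P(1) B(1)] L2_vec_indicator[OF P(1) B(2)]])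
        show "lift T P f t Y' = lift T P f t Y" unfolding lift_def law ..
        fix e :: real
        \<comment> \<open>The scalar \<open>e\<close> is absorbed into the vector, so each point of
          the ray is again a jump on a constant piece.\<close>
        let ?Z' = "perturb T t Y' (\<lambda>w. indicator B' w *\<^sub>R (e *\<^sub>R v))" and ?Z = "perturb T t Y (\<lambda>w. indicator B w *\<^sub>R (e *\<^sub>R v))"
        have m: "?Z' \<in> measurable P (path_space T)" "?Z \<in> measurable P (path_space T)"
          using perturb_L2_paths[OF t Y(2) L2_vec_indicator[OF P(1) B(1), of "e *\<^sub>R v"]]
            perturb_L2_paths[OF t Y(1) L2_vec_indicator[OF P(1) B(2), of "e *\<^sub>R v"]]
          unfolding L2_paths_def by blast+
        have "distr P (path_space T) ?Z' = distr P (path_space T) ?Z"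
        proof (rule measure_eqI)
          fix S assume "S \<in> sets (distr P (path_space T) ?Z')"
          then have S: "S \<in> sets (path_space T)" by simp
          have "measure P (?Z' -` S \<inter> space P) = measure P (?Z -` S \<inter> space P)"
          proof -
            let ?d = "\<lambda>s. c s + (if s \<in> {t..T} then e *\<^sub>R v else 0)"
            have "measure P (?Z' -` S \<inter> space P) = measure (distr P (path_space T) Y') S
                - (if c \<in> S then measure P B' else 0) + (if ?d \<in> S then measure P B' else 0)"
              by (rule measure_perturb_constant_piece[OF t P(1) Y(2) B(1) _ S]) (use c(2) B(3) in blast)
            moreover have "measure P (?Z -` S \<inter> space P) = measure (distr P (path_space T) Y) S
                - (if c \<in> S then measure P B else 0) + (if ?d \<in> S then measure P B else 0)"
              by (rule measure_perturb_constant_piece[OF t P(1) Y(1) B(2) _ S]) (use c(1) B(4) in blast)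
            ultimately show ?thesis unfolding law B(5) by (rule trans[OF _ sym])
          qed
          then show "emeasure (distr P (path_space T) ?Z') S = emeasure (distr P (path_space T) ?Z) S"
            using m S by (simp add: emeasure_distr emeasure_eq_measure)
        qed simp
        then show "lift T P f t (perturb T t Y' (\<lambda>w. e *\<^sub>R indicator B' w *\<^sub>R v)) = lift T P f t (perturb T t Y (\<lambda>w. e *\<^sub>R indicator B w *\<^sub>R v))"
          unfolding lift_def scaleR_left_commute[of e] by (rule arg_cong)
      qed
      then show "(\<integral>w. indicator B' w * (DF Y' w \<bullet> v) \<partial>P) = (\<integral>w. indicator B w * (DF Y w \<bullet> v) \<partial>P)"
        by simp
    qed
    moreover have "(\<integral>w. indicator A w * (DF Y w \<bullet> v) \<partial>P) = (\<integral>w. indicator A w *\<^sub>R DF Y w \<partial>P) \<bullet> v"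
      using integral_inner_left[of v P "\<lambda>w. indicator A w *\<^sub>R DF Y w"] integrable_mult_indicator[OF A(1) int(1)] by simp
    ultimately show ?thesis by simp
  qed
  \<comment> \<open>The exceptional null set depends on \<open>v\<close>; finitely many basis
    vectors suffice.\<close>
  then have "AE w in P. \<forall>v\<in>Basis. w \<in> A' \<longrightarrow> DF Y' w \<bullet> v = ?k \<bullet> v"
    by (intro AE_finite_allI) auto
  then show ?thesis by eventually_elim (auto intro: euclidean_eqI)
qed

section \<open>The representation of the derivative\<close>

definition discretize :: "real \<Rightarrow> real \<Rightarrow> nat \<Rightarrow> (real \<Rightarrow> real^'d) \<Rightarrow> real \<Rightarrow> real^'d" where
  "discretize T t n x = path_decode T n (path_code T n (stopped T t x))"

text \<open>The average of the derivative over the cell with code \<open>l\<close>, built from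
  \<open>X\<close> alone. Cells of probability 0 receive the value 0 through division by
  zero.\<close>

definition discrete_deriv :: "real \<Rightarrow> real \<Rightarrow> 'a measure \<Rightarrow> (('a \<Rightarrow> real \<Rightarrow> real^'d) \<Rightarrow> ('a \<Rightarrow> real^'d)) \<Rightarrow>
    ('a \<Rightarrow> real \<Rightarrow> real^'d) \<Rightarrow> nat \<Rightarrow> (int^'d) list \<Rightarrow> real^'d" where
  "discrete_deriv T t P DF X n l =
    (let A = {w \<in> space P. path_code T n (stopped T t (X w)) = l}
     in (1 / measure P A) *\<^sub>R (\<integral>w. indicator A w *\<^sub>R DF (\<lambda>w. discretize T t n (X w)) w \<partial>P))"

lemma measurable_code_stopped:
  assumes "0 < T" "t \<in> {0..T}"
  shows "(\<lambda>x. path_code T n (stopped T t x)) \<in> measurable (path_filt T t :: (real \<Rightarrow> real^'d::finite) measure) (count_space UNIV)"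
  by (rule measurable_compose[OF measurable_stopped[OF assms(2)] measurable_path_code[OF assms(1)]])

lemma measurable_discretize:
  assumes "0 < T" "t \<in> {0..T}"
  shows "discretize T t n \<in> measurable (path_space T :: (real \<Rightarrow> real^'d::finite) measure) (path_space T)"
proof -
  have 1: "path_decode T n \<in> measurable (count_space UNIV) (path_space T :: (real \<Rightarrow> real^'d) measure)"
    using path_decode_cadlag[OF assms(1)] by (auto simp: measurable_count_space_eq1)
  have 2: "(\<lambda>x::real \<Rightarrow> real^'d. path_code T n (stopped T t x)) \<in> measurable (path_space T) (count_space UNIV)"
    using assms by (intro measurable_compose[OF path_filt_mono measurable_code_stopped]) auto
  show ?thesis using measurable_compose[OF 2 1] by (simp add: discretize_def[abs_def])
qed

text \<open>No event of \<open>path_filt T t\<close> separates a path from its stopped version: this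
  holds for the generators and survives the sigma-algebra operations. It is applied to the level set
  of \<open>\<phi>\<close> through \<open>x\<close>.\<close>

lemma path_filt_measurable_stopped:
  fixes \<phi> :: "(real \<Rightarrow> real^'d::finite) \<Rightarrow> 'b::t1_space"
  assumes \<phi>: "\<phi> \<in> borel_measurable (path_filt T t)" and t: "t \<in> {0..T}" and x: "x \<in> cadlag_paths T"
  shows "\<phi> (stopped T t x) = \<phi> x"
proof -
  have sx: "stopped T t x \<in> cadlag_paths T" by (rule stopped_cadlag[OF x t])
  have "x \<in> E \<longleftrightarrow> stopped T t x \<in> E" if "E \<in> sets (path_filt T t)" for E
    using that unfolding path_filt_def sets_measure_of[OF path_filt_generators]
  proof (induction rule: sigma_sets.induct)
    case (Basic a)
    then obtain s B where s: "s \<in> {0..t}" "a = (\<lambda>\<omega>. \<omega> s) -` B \<inter> cadlag_paths T" by auto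
    have "stopped T t x s = x s" using s t by (simp add: stopped_def)
    then show ?case using x sx by (simp add: s)
  qed (use x sx in auto)
  from this[of "\<phi> -` {\<phi> x} \<inter> cadlag_paths T"] show ?thesis
    using measurable_sets[OF \<phi>, of "{\<phi> x}"] x by auto
qed

text \<open>Uniqueness of limits in mean square, from |a - b|^2 \<le> 2 |h - a|^2 + 2 |h -
  b|^2.\<close>

lemma AE_eq_if_same_limit:
  fixes h :: "nat \<Rightarrow> 'a \<Rightarrow> 'b::euclidean_space"
  assumes [measurable]: "\<And>n. h n \<in> borel_measurable P" "a \<in> borel_measurable P" "b \<in> borel_measurable P"
    and a: "(\<lambda>n. \<integral>\<^sup>+w. ennreal ((norm (h n w - a w))\<^sup>2) \<partial>P) \<longlonglongrightarrow> 0"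
    and b: "(\<lambda>n. \<integral>\<^sup>+w. ennreal ((norm (h n w - b w))\<^sup>2) \<partial>P) \<longlonglongrightarrow> 0"
  shows "AE w in P. a w = b w"
proof -
  let ?A = "\<lambda>n. \<integral>\<^sup>+w. ennreal ((norm (h n w - a w))\<^sup>2) \<partial>P" and ?B = "\<lambda>n. \<integral>\<^sup>+w. ennreal ((norm (h n w - b w))\<^sup>2) \<partial>P"
  let ?I = "\<integral>\<^sup>+w. ennreal ((norm (a w - b w))\<^sup>2) \<partial>P"
  have le: "?I \<le> 2 * ?A n + 2 * ?B n" for n
  proof -
    have "?I \<le> (\<integral>\<^sup>+w. 2 * ennreal ((norm (h n w - a w))\<^sup>2) + 2 * ennreal ((norm (h n w - b w))\<^sup>2) \<partial>P)"
    proof (rule nn_integral_mono)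
      fix w
      have "norm (a w - b w) \<le> norm (h n w - a w) + norm (h n w - b w)"
        using norm_triangle_ineq4[of "h n w - b w" "h n w - a w"] by simp
      then have "(norm (a w - b w))\<^sup>2 \<le> (norm (h n w - a w) + norm (h n w - b w))\<^sup>2"
        by (intro power_mono) auto
      also have "\<dots> \<le> 2 * (norm (h n w - a w))\<^sup>2 + 2 * (norm (h n w - b w))\<^sup>2"
        using zero_le_power2[of "norm (h n w - a w) - norm (h n w - b w)"]
        by (simp add: power2_eq_square algebra_simps)
      finally have "ennreal ((norm (a w - b w))\<^sup>2)
        \<le> ennreal (2 * (norm (h n w - a w))\<^sup>2 + 2 * (norm (h n w - b w))\<^sup>2)" by (rule ennreal_leI)
      also have "\<dots> = 2 * ennreal ((norm (h n w - a w))\<^sup>2) + 2 * ennreal ((norm (h n w - b w))\<^sup>2)"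
        by (simp add: ennreal_plus ennreal_mult)
      finally show "ennreal ((norm (a w - b w))\<^sup>2)
        \<le> 2 * ennreal ((norm (h n w - a w))\<^sup>2) + 2 * ennreal ((norm (h n w - b w))\<^sup>2)" .
    qed
    also have "\<dots> = 2 * ?A n + 2 * ?B n" by (simp add: nn_integral_add nn_integral_cmult)
    finally show ?thesis .
  qed
  have "(\<lambda>n. 2 * ?A n + 2 * ?B n) \<longlonglongrightarrow> 2 * 0 + 2 * 0"
    by (intro tendsto_add ennreal_tendsto_cmult a b) auto
  then have "?I \<le> 2 * 0 + 2 * 0" by (rule LIMSEQ_le_const) (use le in blast)
  then have "?I = 0" by simp
  then have "AE w in P. ennreal ((norm (a w - b w))\<^sup>2) = 0"
    by (subst (asm) nn_integral_0_iff_AE) auto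
  then show ?thesis by eventually_elim simp
qed

locale lift_derivative =
  fixes T t :: real
    and f :: "real \<Rightarrow> (real \<Rightarrow> real^'d::finite) measure \<Rightarrow> real"
    and P :: "'a::polish_space measure"
    and DF :: "('a \<Rightarrow> real \<Rightarrow> real^'d) \<Rightarrow> ('a \<Rightarrow> real^'d)"
  assumes T: "T > 0" and t: "t \<in> {0..T}" and f: "Theta_continuous T f"
    and P: "prob_space P" "sets P = sets borel" "atomless P"
    and F: "frechet_deriv_lift T P f t DF"
    and DF_cont: "DF_continuous T P DF"
begin

sublocale prob_space P by (rule P)

lemma T0: "0 \<le> T" using T by simp

lemma L2_measurable: "X \<in> L2_paths T P \<Longrightarrow> X \<in> measurable P (path_space T)"
  by (simp add: L2_paths_def)

lemma DF_L2: "X \<in> L2_paths T P \<Longrightarrow> DF X \<in> L2_vec P"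
  using F unfolding frechet_deriv_lift_def by blast

lemma discretize_L2:
  fixes X :: "'a \<Rightarrow> real \<Rightarrow> real^'d"
  assumes X: "X \<in> L2_paths T P"
  shows "(\<lambda>w. discretize T t n (X w)) \<in> L2_paths T P"
proof (rule L2_paths_dominated[OF T0 stopped_L2_paths[OF t X], where g="\<lambda>_. real CARD('d)"])
  show "(\<lambda>w. discretize T t n (X w)) \<in> measurable P (path_space T)"
    by (rule measurable_compose[OF L2_measurable[OF X] measurable_discretize[OF T t]])
  fix w M s assume w: "w \<in> space P" and M: "\<And>s. s \<in> {0..T} \<Longrightarrow> norm (stopped T t (X w) s) \<le> M" and s: "s \<in> {0..T}"
  have "stopped T t (X w) \<in> cadlag_paths T"
    using measurable_space[OF L2_measurable[OF X] w] t by (auto intro: stopped_cadlag)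
  from dSK_path_code_le(3)[OF this T M s]
  show "norm (discretize T t n (X w) s) \<le> M + real CARD('d)" by (simp add: discretize_def)
qed auto

lemma discretize_tendsto:
  fixes X :: "'a \<Rightarrow> real \<Rightarrow> real^'d"
  assumes X: "X \<in> L2_paths T P"
  shows "(\<lambda>n. \<integral>\<^sup>+w. ennreal ((dSK T (discretize T t n (X w)) (stopped T t (X w)))\<^sup>2) \<partial>P) \<longlonglongrightarrow> 0"
proof -
  let ?Z = "\<lambda>w. stopped T t (X w)"
  let ?S = "\<lambda>w. SUP s\<in>{0..T}. ennreal ((norm (?Z w s))\<^sup>2)"
  let ?C = "ennreal (2 * (real CARD('d))\<^sup>2)"
  have Z: "?Z \<in> L2_paths T P" by (rule stopped_L2_paths[OF t X])
  have Zc: "?Z w \<in> cadlag_paths T" if "w \<in> space P" for w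
    using measurable_space[OF L2_measurable[OF Z] that] by simp
  note [measurable] = measurable_sup_norm_sq[OF T0 L2_measurable[OF Z]]
  show ?thesis
  \<comment> \<open>The majorant comes from (2 M + d)^2 \<le> 8 M^2 + 2 d^2 with d =
    \<open>CARD('d)\<close> and M^2 the supremum \<open>?S w\<close>.\<close>
  proof (rule nn_integral_dominated_tendsto_0[where w="\<lambda>w. 8 * ?S w + ?C"])
    show "(\<lambda>w. 8 * ?S w + ?C) \<in> borel_measurable P" by measurable
    have "(\<integral>\<^sup>+w. 8 * ?S w + ?C \<partial>P) = 8 * (\<integral>\<^sup>+w. ?S w \<partial>P) + ?C"
      by (simp add: nn_integral_add nn_integral_cmult emeasure_space_1)
    also have "\<dots> < \<infinity>" using Z by (simp add: L2_paths_def ennreal_mult_less_top)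
    finally show "(\<integral>\<^sup>+w. 8 * ?S w + ?C \<partial>P) < \<infinity>" .
  next
    fix n w assume w: "w \<in> space P"
    obtain M where M: "0 \<le> M" "\<And>s. s \<in> {0..T} \<Longrightarrow> norm (?Z w s) \<le> M" "?S w = ennreal (M\<^sup>2)"
      using obtain_sup_norm[OF Zc[OF w] T0] by metis
    let ?d = "dSK T (discretize T t n (X w)) (?Z w)"
    have d: "0 \<le> ?d" "?d \<le> 2 * M + real CARD('d)"
      unfolding discretize_def using dSK_path_code_le(1,2)[OF Zc[OF w] T M(2)] by auto
    have "?d\<^sup>2 \<le> (2 * M + real CARD('d))\<^sup>2" using d by (intro power_mono) auto
    also have "\<dots> \<le> 8 * M\<^sup>2 + 2 * (real CARD('d))\<^sup>2"
      using zero_le_power2[of "2 * M - real CARD('d)"] by (simp add: power2_eq_square algebra_simps)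
    finally have "ennreal (?d\<^sup>2) \<le> ennreal (8 * M\<^sup>2 + 2 * (real CARD('d))\<^sup>2)" by (rule ennreal_leI)
    also have "\<dots> = 8 * ?S w + ?C" unfolding M(3) by (simp add: ennreal_plus ennreal_mult)
    finally show "ennreal (?d\<^sup>2) \<le> 8 * ?S w + ?C" .
  next
    fix w assume w: "w \<in> space P"
    have "(\<lambda>n. (dSK T (discretize T t n (X w)) (?Z w))\<^sup>2) \<longlonglongrightarrow> 0\<^sup>2"
      unfolding discretize_def by (intro tendsto_power dSK_path_code_tendsto[OF Zc[OF w] T])
    then show "(\<lambda>n. ennreal ((dSK T (discretize T t n (X w)) (?Z w))\<^sup>2)) \<longlonglongrightarrow> 0"
      using tendsto_ennrealI by fastforce
  qed
qed

text \<open>Equal laws give the cells of \<open>X\<close> and \<open>X'\<close> with the same code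
  equal probability, and on both cells the discretised path is the decoded code. Hence averages
  taken with \<open>X\<close> describe the derivative at \<open>X'\<close>.\<close>

lemma DF_discretize:
  assumes X: "X \<in> L2_paths T P" "X' \<in> L2_paths T P"
    and law: "distr P (path_space T) X' = distr P (path_space T) X"
  shows "AE w in P. DF (\<lambda>w. discretize T t n (X' w)) w
    = discrete_deriv T t P DF X n (path_code T n (stopped T t (X' w)))"
proof -
  let ?K = "\<lambda>x::real \<Rightarrow> real^'d. path_code T n (stopped T t x)"
  have Km: "?K \<in> measurable (path_space T) (count_space UNIV)"
    using t by (intro measurable_compose[OF path_filt_mono measurable_code_stopped[OF T]]) auto
  have Xm: "X \<in> measurable P (path_space T)" "X' \<in> measurable P (path_space T)"
    using X by (auto intro: L2_measurable)
  have "AE w in P. ?K (X' w) = l \<longrightarrow> DF (\<lambda>w. discretize T t n (X' w)) w = discrete_deriv T t P DF X n l" for l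
  proof -
    define E where "E = {x \<in> cadlag_paths T. ?K x = l}"
    define A where "A = {w \<in> space P. ?K (X w) = l}"
    define A' where "A' = {w \<in> space P. ?K (X' w) = l}"
    have E: "E \<in> sets (path_space T)"
      using measurable_sets[OF Km, of "{l}"] by (simp add: E_def vimage_def Int_def conj_commute)
    have AE: "A = X -` E \<inter> space P" "A' = X' -` E \<inter> space P"
      using measurable_space[OF Xm(1)] measurable_space[OF Xm(2)] by (auto simp: A_def A'_def E_def)
    have "measure P A' = measure P A"
      unfolding AE using measure_distr[OF Xm(1) E] measure_distr[OF Xm(2) E] law by simp
    moreover have "distr P (path_space T) (\<lambda>w. discretize T t n (X' w)) = distr P (path_space T) (\<lambda>w. discretize T t n (X w))"
      using distr_distr[OF measurable_discretize[OF T t] Xm(1)] distr_distr[OF measurable_discretize[OF T t] Xm(2)] law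
      by (simp add: comp_def)
    moreover have "A \<in> sets P" "A' \<in> sets P" unfolding AE using Xm E by (auto intro: measurable_sets)
    ultimately have "AE w in P. w \<in> A' \<longrightarrow> DF (\<lambda>w. discretize T t n (X' w)) w
        = (1 / measure P A) *\<^sub>R (\<integral>w. indicator A w *\<^sub>R DF (\<lambda>w. discretize T t n (X w)) w \<partial>P)"
      by (intro DF_constant_piece[OF t P F, where c="path_decode T n l"] discretize_L2 X)
        (auto simp: A_def A'_def discretize_def)
    with AE_space show ?thesis
      by eventually_elim (auto simp: A'_def A_def discrete_deriv_def Let_def)
  qed
  \<comment> \<open>Countability of the codes merges the null sets of the single cells.\<close>
  then have "AE w in P. \<forall>l. ?K (X' w) = l \<longrightarrow> DF (\<lambda>w. discretize T t n (X' w)) w = discrete_deriv T t P DF X n l"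
    unfolding AE_all_countable by blast
  then show ?thesis by eventually_elim simp
qed

text \<open>The discretised paths converge to the stopped path, so continuity of \<open>DF\<close>
  gives the limit there; \<open>DF_stopped\<close> identifies it with \<open>DF X\<close>.\<close>

lemma DF_discretize_tendsto:
  assumes X: "X \<in> L2_paths T P"
  shows "(\<lambda>n. \<integral>\<^sup>+w. ennreal ((norm (DF (\<lambda>w. discretize T t n (X w)) w - DF X w))\<^sup>2) \<partial>P) \<longlonglongrightarrow> 0"
proof -
  let ?Z = "\<lambda>w. stopped T t (X w)"
  have "(\<lambda>n. \<integral>\<^sup>+w. ennreal ((norm (DF (\<lambda>w. discretize T t n (X w)) w - DF ?Z w))\<^sup>2) \<partial>P) \<longlonglongrightarrow> 0"
    using DF_cont[unfolded DF_continuous_def, rule_format, of "\<lambda>n w. discretize T t n (X w)" ?Z]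
      discretize_L2[OF X] stopped_L2_paths[OF t X] discretize_tendsto[OF X] by blast
  moreover have "(\<integral>\<^sup>+w. ennreal ((norm (DF (\<lambda>w. discretize T t n (X w)) w - DF ?Z w))\<^sup>2) \<partial>P)
      = (\<integral>\<^sup>+w. ennreal ((norm (DF (\<lambda>w. discretize T t n (X w)) w - DF X w))\<^sup>2) \<partial>P)" for n
    by (rule nn_integral_cong_AE) (use DF_stopped[OF t f P(1) F X] in eventually_elim, simp)
  ultimately show ?thesis by simp
qed

lemma discrete_deriv_tendsto:
  assumes X: "X \<in> L2_paths T P" "X' \<in> L2_paths T P"
    and law: "distr P (path_space T) X' = distr P (path_space T) X"
  shows "(\<lambda>n. \<integral>\<^sup>+w. ennreal ((norm (discrete_deriv T t P DF X n (path_code T n (stopped T t (X' w))) - DF X' w))\<^sup>2) \<partial>P) \<longlonglongrightarrow> 0"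
proof -
  have "(\<integral>\<^sup>+w. ennreal ((norm (DF (\<lambda>w. discretize T t n (X' w)) w - DF X' w))\<^sup>2) \<partial>P)
    = (\<integral>\<^sup>+w. ennreal ((norm (discrete_deriv T t P DF X n (path_code T n (stopped T t (X' w))) - DF X' w))\<^sup>2) \<partial>P)" for n
    by (rule nn_integral_cong_AE) (use DF_discretize[OF X law, of n] in eventually_elim, simp)
  with DF_discretize_tendsto[OF X(2)] show ?thesis by simp
qed

text \<open>Almost sure convergence of a subsequence is extracted along \<open>X\<close> only. For
  \<open>X'\<close> it suffices to compare mean square limits, since those of functions on path
  space depend on the law alone.\<close>

lemma derivative_representation:
  assumes X: "X \<in> L2_paths T P"
  shows "\<exists>\<psi>. \<psi> \<in> borel_measurable (path_filt T t) \<and>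
    (\<forall>X'\<in>L2_paths T P. distr P (path_space T) X' = distr P (path_space T) X \<longrightarrow>
       (AE w in P. DF X' w = \<psi> (X' w)))"
proof -
  define h where "h n x = discrete_deriv T t P DF X n (path_code T n (stopped T t x))" for n x
  have hm: "h n \<in> borel_measurable (path_filt T t)" for n
    unfolding h_def by (rule measurable_compose[OF measurable_code_stopped[OF T t]]) simp
  have id: "(\<lambda>x. x) \<in> measurable (path_space T) (path_filt T t)" using t by (intro path_filt_mono) auto
  have hm': "h n \<in> borel_measurable (path_space T)" for n using measurable_compose[OF id hm] .
  let ?Y = "\<lambda>n w. discretize T t n (X w)"
  define u where "u n w = (norm (DF (?Y n) w - DF X w))\<^sup>2" for n w
  have ui: "integrable P (u n)" for n
    using L2_vec_diff[OF DF_L2[OF discretize_L2[OF X, of n]] DF_L2[OF X]] by (simp add: u_def[abs_def] L2_vec_def)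
  have "(\<lambda>n. \<integral>w. u n w \<partial>P) \<longlonglongrightarrow> 0"
  proof -
    have "ennreal (\<integral>w. u n w \<partial>P) = (\<integral>\<^sup>+w. ennreal (u n w) \<partial>P)" for n
      by (intro nn_integral_eq_integral[symmetric] ui) (simp add: u_def)
    then have "(\<lambda>n. ennreal (\<integral>w. u n w \<partial>P)) \<longlonglongrightarrow> 0"
      using DF_discretize_tendsto[OF X] by (simp add: u_def)
    moreover have "0 \<le> (\<integral>w. u n w \<partial>P)" for n by (simp add: u_def)
    ultimately show ?thesis using ennreal_tendsto_0_iff[of "\<lambda>n. \<integral>w. u n w \<partial>P"] by simp
  qed
  moreover have "norm (u n w) = u n w" for n w by (simp add: u_def)
  ultimately have "(\<lambda>n. \<integral>w. norm (u n w) \<partial>P) \<longlonglongrightarrow> 0" by simp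
  from tendsto_L1_AE_subseq[OF ui this] obtain r :: "nat \<Rightarrow> nat" where
    r: "AE w in P. (\<lambda>n. u (r n) w) \<longlonglongrightarrow> 0" by blast
  \<comment> \<open>\<open>lim\<close> is total, so \<open>\<psi>\<close> is measurable on all of
    path space, also at paths where the subsequence diverges.\<close>
  define \<psi> where "\<psi> x = lim (\<lambda>n. h (r n) x)" for x
  have \<psi>m: "\<psi> \<in> borel_measurable (path_filt T t)"
    unfolding \<psi>_def by (intro borel_measurable_lim_metric hm)
  have \<psi>m': "\<psi> \<in> borel_measurable (path_space T)" using measurable_compose[OF id \<psi>m] .
  have "AE w in P. \<forall>n. DF (?Y n) w = h n (X w)"
    unfolding AE_all_countable h_def using DF_discretize[OF X X refl] by blast
  with r have DFX: "AE w in P. DF X w = \<psi> (X w)"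
  proof eventually_elim
    case (elim w)
    have "(\<lambda>n. sqrt (u (r n) w)) \<longlonglongrightarrow> sqrt 0" using elim(1) by (rule tendsto_real_sqrt)
    then have "(\<lambda>n. norm (h (r n) (X w) - DF X w)) \<longlonglongrightarrow> 0" using elim(2) by (simp add: u_def)
    then have "(\<lambda>n. h (r n) (X w)) \<longlonglongrightarrow> DF X w" by (subst (asm) tendsto_norm_zero_iff) (rule LIM_zero_cancel)
    then show ?case unfolding \<psi>_def by (rule limI[symmetric])
  qed
  have "AE w in P. DF X' w = \<psi> (X' w)"
    if X': "X' \<in> L2_paths T P" and law: "distr P (path_space T) X' = distr P (path_space T) X" for X'
  proof (rule AE_eq_if_same_limit[where h="\<lambda>n w. h n (X' w)"])
    note Xm = L2_measurable[OF X] and Xm' = L2_measurable[OF X']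
    show "(\<lambda>w. h n (X' w)) \<in> borel_measurable P" for n by (rule measurable_compose[OF Xm' hm'])
    show "(\<lambda>w. \<psi> (X' w)) \<in> borel_measurable P" by (rule measurable_compose[OF Xm' \<psi>m'])
    show "DF X' \<in> borel_measurable P" using DF_L2[OF X'] by (simp add: L2_vec_def)
    show "(\<lambda>n. \<integral>\<^sup>+w. ennreal ((norm (h n (X' w) - DF X' w))\<^sup>2) \<partial>P) \<longlonglongrightarrow> 0"
      using discrete_deriv_tendsto[OF X X' law] by (simp add: h_def)
    \<comment> \<open>Both sides are the integral of one measurable function on path space against
      the common law.\<close>
    have "(\<integral>\<^sup>+w. ennreal ((norm (h n (X' w) - \<psi> (X' w)))\<^sup>2) \<partial>P)
        = (\<integral>\<^sup>+w. ennreal ((norm (h n (X w) - DF X w))\<^sup>2) \<partial>P)" for n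
    proof -
      have m: "(\<lambda>x. ennreal ((norm (h n x - \<psi> x))\<^sup>2)) \<in> borel_measurable (path_space T)"
        using hm'[of n] \<psi>m' by measurable
      have "(\<integral>\<^sup>+w. ennreal ((norm (h n (X' w) - \<psi> (X' w)))\<^sup>2) \<partial>P)
          = (\<integral>\<^sup>+x. ennreal ((norm (h n x - \<psi> x))\<^sup>2) \<partial>distr P (path_space T) X')"
        using m by (subst nn_integral_distr[OF Xm']) auto
      also have "\<dots> = (\<integral>\<^sup>+w. ennreal ((norm (h n (X w) - \<psi> (X w)))\<^sup>2) \<partial>P)"
        unfolding law using m by (subst nn_integral_distr[OF Xm]) auto
      also have "\<dots> = (\<integral>\<^sup>+w. ennreal ((norm (h n (X w) - DF X w))\<^sup>2) \<partial>P)"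
        by (rule nn_integral_cong_AE) (use DFX in eventually_elim, simp)
      finally show ?thesis .
    qed
    then show "(\<lambda>n. \<integral>\<^sup>+w. ennreal ((norm (h n (X' w) - \<psi> (X' w)))\<^sup>2) \<partial>P) \<longlonglongrightarrow> 0"
      using discrete_deriv_tendsto[OF X X refl] by (simp add: h_def)
  qed
  then show ?thesis using \<psi>m by blast
qed

end

theorem theorem2p2:
  fixes T t :: real
    and f :: "real \<Rightarrow> (real \<Rightarrow> real^'d::finite) measure \<Rightarrow> real"
    and P :: "'a::polish_space measure"
    and DF :: "('a \<Rightarrow> real \<Rightarrow> real^'d) \<Rightarrow> ('a \<Rightarrow> real^'d)"
  assumes "T > 0"
    and "t \<in> {0..T}"
    and "Theta_continuous T f"
    and "prob_space P" and "sets P = sets borel" and "atomless P"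
    and "frechet_deriv_lift T P f t DF"
    and "DF_continuous T P DF"
  shows "\<forall>X\<in>L2_paths T P. \<exists>\<psi>. \<psi> \<in> borel_measurable (path_filt T t) \<and>
      (AE \<omega> in P. DF X \<omega> = \<psi> (stopped T t (X \<omega>))) \<and>
      (\<forall>X'\<in>L2_paths T P. distr P (path_space T) X' = distr P (path_space T) X \<longrightarrow>
         (AE \<omega> in P. DF X' \<omega> = \<psi> (stopped T t (X' \<omega>)))) \<and>
      (\<forall>\<phi>. \<phi> \<in> borel_measurable (path_filt T t) \<longrightarrow>
         (AE \<omega> in P. DF X \<omega> = \<phi> (stopped T t (X \<omega>))) \<longrightarrow>
         (AE x in distr P (path_space T) X. \<phi> x = \<psi> x))"
proof
  fix X :: "'a \<Rightarrow> real \<Rightarrow> real^'d" assume X: "X \<in> L2_paths T P"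
  interpret lift_derivative T t f P DF using assms by (intro lift_derivative.intro)
  obtain \<psi> where \<psi>: "\<psi> \<in> borel_measurable (path_filt T t)"
    and rep: "\<And>X'. X' \<in> L2_paths T P \<Longrightarrow> distr P (path_space T) X' = distr P (path_space T) X \<Longrightarrow>
       AE w in P. DF X' w = \<psi> (X' w)"
    using derivative_representation[OF X] by blast
  have stop: "\<phi> (stopped T t (X' w)) = \<phi> (X' w)"
    if "\<phi> \<in> borel_measurable (path_filt T t)" "X' \<in> L2_paths T P" "w \<in> space P" for \<phi> :: "(real \<Rightarrow> real^'d) \<Rightarrow> real^'d" and X' w
    using path_filt_measurable_stopped[OF that(1) t] measurable_space[OF L2_measurable[OF that(2)] that(3)] by simp
  have rep': "AE w in P. DF X' w = \<psi> (stopped T t (X' w))"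
    if "X' \<in> L2_paths T P" "distr P (path_space T) X' = distr P (path_space T) X" for X'
    using rep[OF that] AE_space by eventually_elim (simp add: stop[OF \<psi> that(1)])
  have unique: "AE x in distr P (path_space T) X. \<phi> x = \<psi> x"
    if \<phi>: "\<phi> \<in> borel_measurable (path_filt T t)" and eq: "AE w in P. DF X w = \<phi> (stopped T t (X w))" for \<phi>
  proof -
    have id: "(\<lambda>x. x) \<in> measurable (path_space T) (path_filt T t)" using t by (intro path_filt_mono) auto
    note [measurable] = measurable_compose[OF id \<phi>] measurable_compose[OF id \<psi>]
    \<comment> \<open>Measurability of the agreement set allows the almost sure equality along
      \<open>X\<close> to be read as one under the law of \<open>X\<close>.\<close>
    have "{x \<in> space (path_space T). \<phi> x = \<psi> x} \<in> sets (path_space T)" by measurable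
    moreover have "AE w in P. \<phi> (X w) = \<psi> (X w)"
      using eq rep[OF X refl] AE_space by eventually_elim (simp add: stop[OF \<phi> X])
    ultimately show ?thesis by (subst AE_distr_iff[OF L2_measurable[OF X]])
  qed
  show "\<exists>\<psi>. \<psi> \<in> borel_measurable (path_filt T t) \<and>
      (AE \<omega> in P. DF X \<omega> = \<psi> (stopped T t (X \<omega>))) \<and>
      (\<forall>X'\<in>L2_paths T P. distr P (path_space T) X' = distr P (path_space T) X \<longrightarrow>
         (AE \<omega> in P. DF X' \<omega> = \<psi> (stopped T t (X' \<omega>)))) \<and>
      (\<forall>\<phi>. \<phi> \<in> borel_measurable (path_filt T t) \<longrightarrow>
         (AE \<omega> in P. DF X \<omega> = \<phi> (stopped T t (X \<omega>))) \<longrightarrow>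
         (AE x in distr P (path_space T) X. \<phi> x = \<psi> x))"
    using \<psi> rep'[OF X refl] rep' unique by blast
qed

end
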